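(* For every $R>0$, the magnitude of the closed Euclidean ball of radius $R$ in $\mathbb{R}^3$ is $$\frac{R^3}{3!}+R^2+2R+1.$$
   Context: Subsets of $\mathbb{R}^n$ carry the Euclidean metric; $\omega_n$ is the volume of the unit ball in $\mathbb{R}^n$. Magnitude: for a finite metric space $(\Xi,d)$, if $w:\Xi\to\mathbb{R}$ satisfies $\sum_{y\in \Xi}e^{-d(x,y)}w(y)=1$ for all $x\in \Xi$, then $|\Xi|:=\sum_{x\in \Xi}w(x)$ (independent of the choice of $w$; such $w$ exists for every finite subset of a Euclidean space). For a compact set $X\subseteq\mathbb{R}^n$, the magnitude is $|X|:=\sup\{|\Xi| : \Xi \text{ a finite subset of } X\}$. By a known theorem of Meckes, for compact $X\subseteq\mathbb{R}^n$ this equals $$|X|=\frac{1}{n!\,\omega_n}\inf\left\{\|f\|^2_{H^{(n+1)/2}(\mathbb{R}^n)} : f\in H^{(n+1)/2}(\mathbb{R}^n),\ f\equiv 1\text{ on }X\right\},$$ where $\|f\|^2_{H^{m}(\mathbb{R}^n)}=\|(I-\Delta)^{m/2}f\|^2_{L^2(\mathbb{R}^n)}$. *)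

theory Defs
  imports "HOL-Analysis.Analysis"
begin

definition weighting :: "'a::metric_space set \<Rightarrow> ('a \<Rightarrow> real) \<Rightarrow> bool" where
  "weighting \<Xi> w \<longleftrightarrow> (\<forall>x\<in>\<Xi>. (\<Sum>y\<in>\<Xi>. exp (- dist x y) * w y) = 1)"

lemma weighting_sum_unique:
  assumes "weighting \<Xi> v" and "weighting \<Xi> w"
  shows "sum v \<Xi> = sum w \<Xi>"
proof -
  have "sum v \<Xi> = (\<Sum>x\<in>\<Xi>. v x * (\<Sum>y\<in>\<Xi>. exp (- dist x y) * w y))"
    using assms(2) by (simp add: weighting_def)
  also have "\<dots> = (\<Sum>x\<in>\<Xi>. \<Sum>y\<in>\<Xi>. v x * (exp (- dist x y) * w y))"
    by (simp add: sum_distrib_left)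
  also have "\<dots> = (\<Sum>y\<in>\<Xi>. \<Sum>x\<in>\<Xi>. v x * (exp (- dist x y) * w y))"
    by (rule sum.swap)
  also have "\<dots> = (\<Sum>y\<in>\<Xi>. w y * (\<Sum>x\<in>\<Xi>. exp (- dist y x) * v x))"
    by (simp add: sum_distrib_left dist_commute mult_ac)
  also have "\<dots> = sum w \<Xi>"
    using assms(1) by (simp add: weighting_def)
  finally show ?thesis .
qed

text \<open>
  The description below is unspecified when \<open>\<Xi>\<close> has no weighting; every finite subset of a
  Euclidean space has one, since the kernel \<open>exp (- dist x y)\<close> is positive definite there.
\<close>

definition finite_magnitude :: "'a::metric_space set \<Rightarrow> real" where
  "finite_magnitude \<Xi> = (THE m. \<exists>w. weighting \<Xi> w \<and> m = sum w \<Xi>)"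

lemma finite_magnitude_eq: "weighting \<Xi> w \<Longrightarrow> finite_magnitude \<Xi> = sum w \<Xi>"
  unfolding finite_magnitude_def
  by (rule the_equality) (auto intro: weighting_sum_unique)

text \<open>
  The supremum is taken in the extended reals, so that a finite value of the magnitude
  includes the assertion that the magnitudes of finite subsets are bounded. It is meant for
  compact \<open>X\<close>.
\<close>

definition magnitude :: "'a::euclidean_space set \<Rightarrow> ereal" where
  "magnitude X = (SUP \<Xi>\<in>{\<Xi>. finite \<Xi> \<and> \<Xi> \<subseteq> X}. ereal (finite_magnitude \<Xi>))"

end

theory Submission
  imports Defs "HOL-Real_Asymp.Real_Asymp"
begin

text \<open>
  The kernel \<open>exp (- dist x y)\<close> is a mixture of Gaussians, hence positive definite, and duality
  turns the magnitude of \<open>X\<close> into the energy of any charge on \<open>X\<close> whose potential is 1 on \<open>X\<close>.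
  For the ball of radius \<open>R\<close> in three dimensions this charge is a distribution: a constant density,
  a multiple of the surface measure and a multiple of its normal derivative. Averaging the kernel
  over spheres (Archimedes) makes the problem one-dimensional, with kernel
  \<open>(matern (r - s) - matern (r + s)) / 2\<close> on \<open>{0..R}\<close> and target potential \<open>s\<close>. Finitely many
  nodes approximate the charge, the normal derivative becoming a difference quotient at the mesh
  size; potential, energy and total charge converge as the mesh tends to 0.
\<close>

text \<open>The Fourier transform of exp (-|x|) on R^3 is a multiple of (1 + |xi|^2)^(-2), so the
  charge is a multiple of (I - Laplacian)^2 applied to its potential. This gives the constant
  density 1/(8 pi) inside and, on the sphere, where second and third normal derivatives of the
  potential may jump, just two layers. For s <= R <= r the radial kernel separates as exp (-r) ((1 +
  r) sinh s - s cosh s), so any charge beyond R acts inside only through the two functions sinh s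
  and s cosh s. Matching their coefficients determines the layer strengths
  \<open>(2 * R + 3) / 2\<close> and \<open>(R + 2) / 2\<close>. The obstacle is the energy. The
  normal derivative becomes a quotient with the mesh size h in its denominator, and the energy
  applies this quotient to the error of the potential. An error of order h is therefore not good
  enough: the errors at R and R - h must agree up to o(h). They do because the radial kernel has a
  continuous mixed second derivative at (R, R).\<close>

section \<open>Positive definiteness of the kernel\<close>

text \<open>Expanding one factor of the power over \<open>Basis\<close> moves the coordinates into
  the coefficients and lowers the exponent by one. This is why the induction keeps \<open>v\<close>
  arbitrary.\<close>

lemma sum_inner_power_nonneg:
  fixes p :: "'i \<Rightarrow> 'a::euclidean_space"
  shows "0 \<le> (\<Sum>i\<in>I. \<Sum>j\<in>I. v i * v j * (p i \<bullet> p j) ^ k)"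
proof (induction k arbitrary: v)
  case 0
  have "(\<Sum>i\<in>I. \<Sum>j\<in>I. v i * v j * (p i \<bullet> p j) ^ 0) = (sum v I)\<^sup>2"
    by (simp add: power2_eq_square sum_product)
  then show ?case by simp
next
  case (Suc k)
  have "(\<Sum>i\<in>I. \<Sum>j\<in>I. v i * v j * (p i \<bullet> p j) ^ Suc k)
      = (\<Sum>i\<in>I. \<Sum>j\<in>I. \<Sum>b\<in>Basis. (v i * (p i \<bullet> b)) * (v j * (p j \<bullet> b)) * (p i \<bullet> p j) ^ k)"
    by (intro sum.cong refl, subst power_Suc, subst (1) euclidean_inner)
       (simp add: sum_distrib_left sum_distrib_right mult_ac)
  also have "\<dots> = (\<Sum>i\<in>I. \<Sum>b\<in>Basis. \<Sum>j\<in>I. (v i * (p i \<bullet> b)) * (v j * (p j \<bullet> b)) * (p i \<bullet> p j) ^ k)"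
    by (intro sum.cong refl sum.swap)
  also have "\<dots> = (\<Sum>b\<in>Basis. \<Sum>i\<in>I. \<Sum>j\<in>I. (v i * (p i \<bullet> b)) * (v j * (p j \<bullet> b)) * (p i \<bullet> p j) ^ k)"
    by (rule sum.swap)
  also have "\<dots> \<ge> 0"
    by (intro sum_nonneg Suc.IH)
  finally show ?case .
qed

text \<open>The exponential series has nonnegative coefficients, so the form is a convergent sum of
  nonnegative ones.\<close>

lemma sum_exp_inner_nonneg:
  fixes p :: "'i \<Rightarrow> 'a::euclidean_space"
  assumes "c \<ge> 0"
  shows "0 \<le> (\<Sum>i\<in>I. \<Sum>j\<in>I. v i * v j * exp (c * (p i \<bullet> p j)))"
proof -
  have "(\<lambda>k. \<Sum>i\<in>I. \<Sum>j\<in>I. v i * v j * ((c * (p i \<bullet> p j)) ^ k /\<^sub>R fact k)) sums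
        (\<Sum>i\<in>I. \<Sum>j\<in>I. v i * v j * exp (c * (p i \<bullet> p j)))"
    by (intro sums_sum sums_mult exp_converges)
  moreover have "0 \<le> (\<Sum>i\<in>I. \<Sum>j\<in>I. v i * v j * ((c * (p i \<bullet> p j)) ^ k /\<^sub>R fact k))" for k
  proof -
    have "(\<Sum>i\<in>I. \<Sum>j\<in>I. v i * v j * ((c * (p i \<bullet> p j)) ^ k /\<^sub>R fact k))
        = (c ^ k / fact k) * (\<Sum>i\<in>I. \<Sum>j\<in>I. v i * v j * (p i \<bullet> p j) ^ k)"
      by (simp add: sum_distrib_left power_mult_distrib divide_inverse mult_ac)
    also have "\<dots> \<ge> 0"
      using assms by (intro mult_nonneg_nonneg sum_inner_power_nonneg) auto
    finally show ?thesis .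
  qed
  ultimately show ?thesis by (rule sums_le[OF _ sums_zero, rotated])
qed

text \<open>When the square is expanded, the squared norms become factors depending on one point
  each and are absorbed into the coefficients.\<close>

lemma sum_gaussian_nonneg:
  fixes p :: "'i \<Rightarrow> 'a::euclidean_space"
  assumes "c \<ge> 0"
  shows "0 \<le> (\<Sum>i\<in>I. \<Sum>j\<in>I. v i * v j * exp (- c * (dist (p i) (p j))\<^sup>2))"
proof -
  have "exp (- c * (dist (p i) (p j))\<^sup>2)
      = exp (- c * (p i \<bullet> p i)) * exp (- c * (p j \<bullet> p j)) * exp (2 * c * (p i \<bullet> p j))" for i j
    unfolding dist_norm power2_norm_eq_inner exp_add[symmetric]
    by (simp add: algebra_simps inner_commute)
  then have "(\<Sum>i\<in>I. \<Sum>j\<in>I. v i * v j * exp (- c * (dist (p i) (p j))\<^sup>2))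
    = (\<Sum>i\<in>I. \<Sum>j\<in>I. (v i * exp (- c * (p i \<bullet> p i))) * (v j * exp (- c * (p j \<bullet> p j)))
        * exp ((2 * c) * (p i \<bullet> p j)))"
    by (simp add: mult_ac)
  also have "\<dots> \<ge> 0"
    using assms by (intro sum_exp_inner_nonneg) auto
  finally show ?thesis .
qed

section \<open>The exponential kernel as a mixture of Gaussians\<close>

lemma gaussian_antiderivative:
  obtains E :: "real \<Rightarrow> real" and L where
    "\<And>x. (E has_real_derivative exp (- x\<^sup>2)) (at x)" "\<And>x. E (- x) = - E x"
    "(E \<longlongrightarrow> L) at_top" "L > 0"
proof -
  obtain F :: "real \<Rightarrow> real" where F: "\<And>x. (F has_real_derivative exp (- x\<^sup>2)) (at x)"
    using einterval_antiderivative[of "-\<infinity>" "\<infinity>" "\<lambda>x::real. exp (- x\<^sup>2)"]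
    by (auto simp: has_real_derivative_iff_has_vector_derivative)
  define E where "E x = (F x - F (- x)) / 2" for x
  have dE: "(E has_real_derivative exp (- x\<^sup>2)) (at x)" for x
    unfolding E_def by (auto intro!: derivative_eq_intros F DERIV_chain2[OF F])
  have odd: "E (- x) = - E x" for x by (simp add: E_def field_simps)
  have mono: "E x \<le> E y" if "x \<le> y" for x y
    using that by (rule DERIV_nonneg_imp_nondecreasing) (auto intro: dE)
  have "E 0 = 0" by (simp add: E_def)
  \<comment> \<open>For t >= 1 the Gaussian is at most exp (- t), so adding exp (- x) turns
    \<open>E\<close> into a nonincreasing function.\<close>
  have bound: "E x + exp (- x) \<le> E 1 + exp (- 1)" if "x \<ge> 1" for x
  proof (rule DERIV_nonpos_imp_nonincreasing[OF that])
    fix t :: real assume t: "1 \<le> t" "t \<le> x"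
    have "t * 1 \<le> t * t" using t by (intro mult_left_mono) auto
    then show "\<exists>y. ((\<lambda>x. E x + exp (- x)) has_real_derivative y) (at t) \<and> y \<le> 0"
      by (intro exI[of _ "exp (- t\<^sup>2) - exp (- t)"])
         (auto intro!: derivative_eq_intros dE simp: power2_eq_square)
  qed
  have bounded: "E x \<le> E 1 + exp (- 1)" for x
    using mono[of x 1] bound[of x] by (cases "x \<ge> 1") (auto intro: order_trans[rotated] simp: add_increasing2)
  have bdd: "bdd_above (range E)" using bounded by (auto intro!: bdd_aboveI)
  define L where "L = (SUP x. E x)"
  have "(E \<longlongrightarrow> L) at_top"
  proof (rule order_tendstoI)
    fix a assume "a < L"
    then obtain x where "a < E x" unfolding L_def using bdd by (subst (asm) less_cSUP_iff) auto
    then show "\<forall>\<^sub>F x in at_top. a < E x"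
      using mono by (auto intro!: eventually_at_top_linorderI[of x] intro: less_le_trans)
  next
    fix a assume "L < a"
    then show "\<forall>\<^sub>F x in at_top. E x < a"
      unfolding L_def using bdd by (auto intro!: always_eventually intro: le_less_trans cSUP_upper)
  qed
  moreover have "E 0 < E 1"
    by (rule DERIV_pos_imp_increasing) (auto intro!: dE exI)
  then have "L > 0"
    unfolding L_def using cSUP_upper[OF _ bdd, of 1] \<open>E 0 = 0\<close> by auto
  ultimately show ?thesis using that dE odd by blast
qed

text \<open>The aim is that the integral of exp (- t^2 - a^2 / t^2) over t > 0 is a constant
  multiple of exp (- 2 a). The antiderivative comes from completing the square in two ways, t^2 +
  a^2 / t^2 = (t + a / t)^2 - 2 a = (t - a / t)^2 + 2 a. The inner derivatives 1 - a / t^2 and 1 + a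
  / t^2 average to 1.\<close>

lemma gaussian_mixture_FTC:
  fixes E :: "real \<Rightarrow> real"
  assumes E: "\<And>x. (E has_real_derivative exp (- x\<^sup>2)) (at x)" and "0 < l" "l \<le> u"
  defines "F \<equiv> \<lambda>a t. (exp (2 * a) * E (t + a / t) + exp (- 2 * a) * E (t - a / t)) / 2"
  shows "((\<lambda>t. exp (- t\<^sup>2) * exp (- (1 / t\<^sup>2) * a\<^sup>2)) has_integral F a u - F a l) {l..u}"
proof (rule fundamental_theorem_of_calculus[OF \<open>l \<le> u\<close>], unfold has_real_derivative_iff_has_vector_derivative[symmetric])
  fix t assume "t \<in> {l..u}"
  then have t: "t > 0" using \<open>0 < l\<close> by auto
  have e: "exp (2 * a) * exp (- (t + a / t)\<^sup>2) = exp (- t\<^sup>2) * exp (- (1 / t\<^sup>2) * a\<^sup>2)"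
       "exp (- 2 * a) * exp (- (t - a / t)\<^sup>2) = exp (- t\<^sup>2) * exp (- (1 / t\<^sup>2) * a\<^sup>2)"
    using t unfolding exp_add[symmetric] by (simp_all add: power2_eq_square field_simps)
  have "(F a has_real_derivative (exp (2 * a) * (exp (- (t + a / t)\<^sup>2) * (1 - a / t\<^sup>2))
        + exp (- 2 * a) * (exp (- (t - a / t)\<^sup>2) * (1 + a / t\<^sup>2))) / 2) (at t)"
    unfolding F_def using t
    by (auto intro!: derivative_eq_intros DERIV_chain2[OF E] simp: power2_eq_square)
  also have "(exp (2 * a) * (exp (- (t + a / t)\<^sup>2) * (1 - a / t\<^sup>2))
        + exp (- 2 * a) * (exp (- (t - a / t)\<^sup>2) * (1 + a / t\<^sup>2))) / 2
      = exp (- t\<^sup>2) * exp (- (1 / t\<^sup>2) * a\<^sup>2)"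
    unfolding mult.assoc[symmetric] e by (simp add: algebra_simps)
  finally show "(F a has_real_derivative exp (- t\<^sup>2) * exp (- (1 / t\<^sup>2) * a\<^sup>2)) (at t within {l..u})"
    by (rule has_field_derivative_at_within)
qed

lemma gaussian_mixture_limit:
  fixes E :: "real \<Rightarrow> real"
  assumes E: "\<And>x. (E has_real_derivative exp (- x\<^sup>2)) (at x)" and odd: "\<And>x. E (- x) = - E x"
    and L: "(E \<longlongrightarrow> L) at_top" and "a \<ge> 0"
  defines "F \<equiv> \<lambda>a t. (exp (2 * a) * E (t + a / t) + exp (- 2 * a) * E (t - a / t)) / 2"
  shows "((\<lambda>t. F a t - F a (1 / t)) \<longlongrightarrow> L * exp (- 2 * a)) at_top"
proof -
  have Lm: "(E \<longlongrightarrow> - L) at_bot"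
  proof -
    have "((\<lambda>x. - E (- x)) \<longlongrightarrow> - L) at_bot"
      by (intro tendsto_minus filterlim_compose[OF L] filterlim_uminus_at_top_at_bot)
    then show ?thesis by (simp add: odd)
  qed
  have E0: "E 0 = 0" using odd[of 0] by simp
  have isC: "isCont E x" for x using E DERIV_isCont by blast
  have "((\<lambda>t. E (t + a / t)) \<longlongrightarrow> L) at_top"
    by (rule filterlim_compose[OF L]) real_asymp
  moreover have "((\<lambda>t. E (t - a / t)) \<longlongrightarrow> L) at_top"
    by (rule filterlim_compose[OF L]) real_asymp
  ultimately have 1: "(F a \<longlongrightarrow> (exp (2 * a) * L + exp (- 2 * a) * L) / 2) at_top"
    unfolding F_def by (intro tendsto_intros) auto
  \<comment> \<open>At the lower end the arguments 1 / t + a t and 1 / t - a t tend to plus and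
    minus infinity when a > 0, so the halves get opposite signs. For a = 0 both arguments tend to 0,
    and the claimed limit is 0 too.\<close>
  have 2: "((\<lambda>t. F a (1 / t)) \<longlongrightarrow> (exp (2 * a) * L - exp (- 2 * a) * L) / 2) at_top"
  proof (cases "a = 0")
    case True
    have "((\<lambda>t. E (1 / t)) \<longlongrightarrow> E 0) at_top"
      by (rule isCont_tendsto_compose[OF isC]) real_asymp
    then show ?thesis unfolding F_def True by (simp add: E0)
  next
    case False
    with \<open>a \<ge> 0\<close> have a: "a > 0" by simp
    have "((\<lambda>t. E (1 / t + a / (1 / t))) \<longlongrightarrow> L) at_top"
      by (rule filterlim_compose[OF L]) (use a in real_asymp)
    moreover have "((\<lambda>t. E (1 / t - a / (1 / t))) \<longlongrightarrow> - L) at_top"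
      by (rule filterlim_compose[OF Lm]) (use a in real_asymp)
    ultimately have "((\<lambda>t. F a (1 / t)) \<longlongrightarrow> (exp (2 * a) * L + exp (- 2 * a) * - L) / 2) at_top"
      unfolding F_def by (intro tendsto_intros) auto
    then show ?thesis by simp
  qed
  show ?thesis using tendsto_diff[OF 1 2] by (simp add: field_simps)
qed

text \<open>With \<open>a\<close> half the distance and t restricted to a compact interval, the form
  is an integral of Gaussian forms. As the interval exhausts the half-line, it tends to the kernel
  form times \<open>L\<close>, which is positive.\<close>

lemma energy_nonneg:
  fixes p :: "'i \<Rightarrow> 'a::euclidean_space"
  shows "0 \<le> (\<Sum>i\<in>I. \<Sum>j\<in>I. v i * v j * exp (- dist (p i) (p j)))"
proof -
  obtain E :: "real \<Rightarrow> real" and L where E: "\<And>x. (E has_real_derivative exp (- x\<^sup>2)) (at x)"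
    and odd: "\<And>x. E (- x) = - E x" and L: "(E \<longlongrightarrow> L) at_top" and "L > 0"
    using gaussian_antiderivative by metis
  define F where "F a t = (exp (2 * a) * E (t + a / t) + exp (- 2 * a) * E (t - a / t)) / 2" for a t
  define d where "d i j = dist (p i) (p j) / 2" for i j
  have "((\<lambda>t. \<Sum>i\<in>I. \<Sum>j\<in>I. v i * v j * (F (d i j) t - F (d i j) (1 / t))) \<longlongrightarrow>
      (\<Sum>i\<in>I. \<Sum>j\<in>I. v i * v j * (L * exp (- 2 * d i j)))) at_top"
    unfolding F_def
    by (intro tendsto_sum tendsto_mult tendsto_const gaussian_mixture_limit E odd L) (simp add: d_def)
  moreover have "\<forall>\<^sub>F t in at_top. 0 \<le> (\<Sum>i\<in>I. \<Sum>j\<in>I. v i * v j * (F (d i j) t - F (d i j) (1 / t)))"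
    using eventually_ge_at_top[of 1]
  proof eventually_elim
    fix t :: real assume t: "t \<ge> 1"
    then have "1 / t \<le> 1" by simp
    with t have t': "1 / t \<le> t" by linarith
    have "((\<lambda>x. \<Sum>i\<in>I. \<Sum>j\<in>I. v i * v j * (exp (- x\<^sup>2) * exp (- (1 / x\<^sup>2) * (d i j)\<^sup>2)))
       has_integral (\<Sum>i\<in>I. \<Sum>j\<in>I. v i * v j * (F (d i j) t - F (d i j) (1 / t)))) {1 / t..t}"
    proof (cases "finite I")
      case True
      then show ?thesis
        unfolding F_def using t t'
        by (intro has_integral_sum has_integral_mult_right gaussian_mixture_FTC[OF E]) auto
    qed simp
    then show "0 \<le> (\<Sum>i\<in>I. \<Sum>j\<in>I. v i * v j * (F (d i j) t - F (d i j) (1 / t)))"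
    proof (rule has_integral_nonneg)
      fix x
      have "(\<Sum>i\<in>I. \<Sum>j\<in>I. v i * v j * (exp (- x\<^sup>2) * exp (- (1 / x\<^sup>2) * (d i j)\<^sup>2)))
        = exp (- x\<^sup>2) * (\<Sum>i\<in>I. \<Sum>j\<in>I. v i * v j * exp (- (1 / x\<^sup>2 / 4) * (dist (p i) (p j))\<^sup>2))"
        by (simp add: sum_distrib_left d_def power_divide mult_ac)
      then show "0 \<le> (\<Sum>i\<in>I. \<Sum>j\<in>I. v i * v j * (exp (- x\<^sup>2) * exp (- (1 / x\<^sup>2) * (d i j)\<^sup>2)))"
        using sum_gaussian_nonneg[where c = "1 / x\<^sup>2 / 4" and p = p and v = v and I = I] by simp
    qed
  qed
  ultimately have "0 \<le> (\<Sum>i\<in>I. \<Sum>j\<in>I. v i * v j * (L * exp (- 2 * d i j)))"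
    by (rule tendsto_lowerbound) simp
  also have "\<dots> = L * (\<Sum>i\<in>I. \<Sum>j\<in>I. v i * v j * exp (- dist (p i) (p j)))"
    by (simp add: sum_distrib_left d_def mult_ac)
  finally show ?thesis using \<open>L > 0\<close> by (simp add: zero_le_mult_iff)
qed

section \<open>Weightings and duality\<close>

text \<open>Both charges are put side by side on the disjoint sum of the index sets, where
  nonnegativity makes a binary quadratic form in their multiples \<open>s\<close> and
  \<open>t\<close>. Charges are indexed families, so points may be repeated or shared.\<close>

lemma energy_Cauchy_Schwarz:
  fixes p :: "'i \<Rightarrow> 'a::euclidean_space" and q :: "'j \<Rightarrow> 'a"
  assumes "finite I" "finite J"
  shows "(\<Sum>i\<in>I. \<Sum>j\<in>J. v i * w j * exp (- dist (p i) (q j)))\<^sup>2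
    \<le> (\<Sum>i\<in>I. \<Sum>k\<in>I. v i * v k * exp (- dist (p i) (p k)))
      * (\<Sum>j\<in>J. \<Sum>k\<in>J. w j * w k * exp (- dist (q j) (q k)))"
    (is "?X\<^sup>2 \<le> ?A * ?B")
proof -
  have quad: "0 \<le> ?A * s\<^sup>2 + 2 * ?X * s * t + ?B * t\<^sup>2" for s t
  proof -
    define u where "u = case_sum (\<lambda>i. s * v i) (\<lambda>j. t * w j)"
    define r where "r = case_sum p q"
    have "0 \<le> (\<Sum>i\<in>I <+> J. \<Sum>j\<in>I <+> J. u i * u j * exp (- dist (r i) (r j)))"
      by (rule energy_nonneg)
    also have "\<dots> = (\<Sum>i\<in>I. \<Sum>k\<in>I. s * v i * (s * v k) * exp (- dist (p i) (p k)))
        + (\<Sum>i\<in>I. \<Sum>j\<in>J. s * v i * (t * w j) * exp (- dist (p i) (q j)))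
        + ((\<Sum>j\<in>J. \<Sum>i\<in>I. t * w j * (s * v i) * exp (- dist (q j) (p i)))
        + (\<Sum>j\<in>J. \<Sum>k\<in>J. t * w j * (t * w k) * exp (- dist (q j) (q k))))"
      using assms by (simp add: sum.Plus sum.distrib u_def r_def)
    also have "(\<Sum>j\<in>J. \<Sum>i\<in>I. t * w j * (s * v i) * exp (- dist (q j) (p i)))
        = (\<Sum>i\<in>I. \<Sum>j\<in>J. s * v i * (t * w j) * exp (- dist (p i) (q j)))"
      by (subst sum.swap) (simp add: dist_commute mult_ac)
    also have "(\<Sum>i\<in>I. \<Sum>k\<in>I. s * v i * (s * v k) * exp (- dist (p i) (p k))) = ?A * s\<^sup>2"
      by (simp add: sum_distrib_right sum_distrib_left power2_eq_square mult_ac)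
    also have "(\<Sum>j\<in>J. \<Sum>k\<in>J. t * w j * (t * w k) * exp (- dist (q j) (q k))) = ?B * t\<^sup>2"
      by (simp add: sum_distrib_right sum_distrib_left power2_eq_square mult_ac)
    also have "(\<Sum>i\<in>I. \<Sum>j\<in>J. s * v i * (t * w j) * exp (- dist (p i) (q j))) = ?X * s * t"
      by (simp add: sum_distrib_right sum_distrib_left mult_ac)
    finally show ?thesis by (simp add: algebra_simps)
  qed
  have A: "0 \<le> ?A" by (rule energy_nonneg)
  show ?thesis
  proof (cases "?A = 0")
    case True
    \<comment> \<open>With \<open>?A = 0\<close> the form is affine in \<open>s\<close>; a nonzero
      cross term would allow the value -1, attained at the chosen multiple.\<close>
    have "?X = 0"
    proof (rule ccontr)
      assume X: "?X \<noteq> 0"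
      have "0 \<le> 2 * ?X * (- (?B + 1) / (2 * ?X)) * 1 + ?B * 1\<^sup>2"
        using quad[of "- (?B + 1) / (2 * ?X)" 1] unfolding True by simp
      then show False using X by simp
    qed
    then show ?thesis using True by simp
  next
    case False
    with A have A': "?A > 0" by simp
    have "?A * ?X\<^sup>2 \<le> ?A * (?A * ?B)"
      using quad[of "- ?X" "?A"] by (simp add: power2_eq_square algebra_simps)
    then show ?thesis using A' by simp
  qed
qed

section \<open>Strict definiteness and existence of weightings\<close>

lemma exp_minus_abs_not_differentiable:
  "\<not> ((\<lambda>t::real. c * exp (- \<bar>t\<bar>)) has_real_derivative D) (at 0)" if "c \<noteq> 0"
proof
  assume D: "((\<lambda>t::real. c * exp (- \<bar>t\<bar>)) has_real_derivative D) (at 0)"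
  have "((\<lambda>h. (c * exp (- \<bar>0 + h\<bar>) - c * exp (- \<bar>0\<bar>)) / h) \<longlongrightarrow> D) (at_right 0)"
       "((\<lambda>h. (c * exp (- \<bar>0 + h\<bar>) - c * exp (- \<bar>0\<bar>)) / h) \<longlongrightarrow> D) (at_left 0)"
    using D unfolding DERIV_def by (auto simp: filterlim_at_split)
  moreover have "((\<lambda>h. (c * exp (- \<bar>0 + h\<bar>) - c * exp (- \<bar>0\<bar>)) / h) \<longlongrightarrow> - c) (at_right 0)"
  proof -
    have "((\<lambda>h. c * ((exp (- h) - 1) / h)) \<longlongrightarrow> c * (- 1)) (at_right (0::real))"
      by (rule tendsto_mult_left) real_asymp
    then have "((\<lambda>h. (c * exp (- h) - c) / h) \<longlongrightarrow> - c) (at_right (0::real))"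
      by (simp add: algebra_simps diff_divide_distrib)
    then show ?thesis
      by (rule Lim_transform_eventually) (auto simp: eventually_at_right_less intro!: eventually_at_rightI[of 0 1])
  qed
  moreover have "((\<lambda>h. (c * exp (- \<bar>0 + h\<bar>) - c * exp (- \<bar>0\<bar>)) / h) \<longlongrightarrow> c) (at_left 0)"
  proof -
    have "((\<lambda>h. c * ((exp h - 1) / h)) \<longlongrightarrow> c * 1) (at_left (0::real))"
      by (rule tendsto_mult_left) real_asymp
    then have "((\<lambda>h. (c * exp h - c) / h) \<longlongrightarrow> c) (at_left (0::real))"
      by (simp add: algebra_simps diff_divide_distrib)
    then show ?thesis
      by (rule Lim_transform_eventually) (auto intro!: eventually_at_leftI[of "-1" 0])
  qed
  ultimately have "D = - c" "D = c"
    using tendsto_unique[OF trivial_limit_at_right_real] tendsto_unique[OF trivial_limit_at_left_real] by blast+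
  then show False using that by simp
qed

lemma dist_line_differentiable:
  fixes x y e :: "'a::euclidean_space"
  assumes "x \<noteq> y"
  shows "(\<lambda>t::real. dist (x + t *\<^sub>R e) y) differentiable (at 0)"
proof -
  have "(\<lambda>t::real. norm (x + t *\<^sub>R e - y)) differentiable (at 0)"
    by (rule differentiable_compose[of norm "\<lambda>t. x + t *\<^sub>R e - y"])
       (use assms in \<open>auto intro!: differentiable_norm_at derivative_intros\<close>)
  then show ?thesis by (simp add: dist_norm)
qed

text \<open>A vanishing energy forces a vanishing potential by Cauchy--Schwarz, while the kernel
  has a corner on the diagonal.\<close>

lemma energy_zero_imp_zero:
  fixes A :: "'a::euclidean_space set"
  assumes "finite A" and z: "(\<Sum>x\<in>A. \<Sum>y\<in>A. v x * v y * exp (- dist x y)) = 0" and "a \<in> A"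
  shows "v a = 0"
proof (rule ccontr)
  assume va: "v a \<noteq> 0"
  have pot: "(\<Sum>x\<in>A. v x * exp (- dist z x)) = 0" for z
  proof -
    \<comment> \<open>A unit test charge at \<open>z\<close> makes the cross term the potential at
      \<open>z\<close>.\<close>
    have "(\<Sum>x\<in>A. \<Sum>j\<in>{()}. v x * 1 * exp (- dist x z))\<^sup>2 \<le> 0"
      using energy_Cauchy_Schwarz[of A "{()}" v "\<lambda>_. 1" "\<lambda>x. x" "\<lambda>_. z"] assms by simp
    then show ?thesis by (simp add: dist_commute)
  qed
  obtain e :: 'a where e: "e \<in> Basis" using nonempty_Basis by blast
  have exp_diff: "(\<lambda>t::real. exp (- dist (a + t *\<^sub>R e) x)) differentiable (at 0)" if ne: "x \<noteq> a" for x
  proof -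
    obtain D where "((\<lambda>t::real. dist (a + t *\<^sub>R e) x) has_real_derivative D) (at 0)"
      using dist_line_differentiable[of a x e] ne real_differentiable_def by blast
    then have "((\<lambda>t::real. exp (- dist (a + t *\<^sub>R e) x)) has_real_derivative exp (- dist (a + 0 *\<^sub>R e) x) * - D) (at 0)"
      by (intro derivative_intros)
    then show ?thesis using real_differentiable_def by blast
  qed
  \<comment> \<open>The total potential is 0 along the line through \<open>a\<close>, so the term of
    \<open>a\<close> is minus the sum of the others, each of which is differentiable at
    \<open>a\<close>.\<close>
  have "(\<lambda>t::real. - (\<Sum>x\<in>A - {a}. v x * exp (- dist (a + t *\<^sub>R e) x))) differentiable (at 0)"
    using \<open>finite A\<close> exp_diff
    by (intro differentiable_minus differentiable_sum differentiable_mult differentiable_const) auto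
  also have "(\<lambda>t::real. - (\<Sum>x\<in>A - {a}. v x * exp (- dist (a + t *\<^sub>R e) x)))
      = (\<lambda>t. v a * exp (- \<bar>t\<bar>))"
  proof
    fix t :: real
    show "- (\<Sum>x\<in>A - {a}. v x * exp (- dist (a + t *\<^sub>R e) x)) = v a * exp (- \<bar>t\<bar>)"
      using pot[of "a + t *\<^sub>R e"] \<open>finite A\<close> \<open>a \<in> A\<close> e
      by (simp add: sum.remove dist_norm)
  qed
  finally obtain D where "((\<lambda>t::real. v a * exp (- \<bar>t\<bar>)) has_real_derivative D) (at 0)"
    using real_differentiable_def by blast
  with exp_minus_abs_not_differentiable[OF va] show False by blast
qed

text \<open>Bordering by one point: the Schur complement \<open>s\<close> cannot vanish, since the
  charge 1 at \<open>z\<close> and \<open>- u\<close> on \<open>A\<close> would then have zero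
  energy. The right-hand side stays arbitrary because the induction hypothesis is also applied to
  the column of \<open>z\<close>.\<close>

lemma kernel_system_solvable:
  fixes A :: "'a::euclidean_space set"
  assumes "finite A"
  shows "\<exists>w. \<forall>x\<in>A. (\<Sum>y\<in>A. exp (- dist x y) * w y) = g x"
  using assms
proof (induction A arbitrary: g rule: finite_induct)
  case empty
  then show ?case by simp
next
  case (insert z A)
  obtain w0 where w0: "\<And>x. x \<in> A \<Longrightarrow> (\<Sum>y\<in>A. exp (- dist x y) * w0 y) = g x"
    using insert.IH[of g] by blast
  obtain u where u: "\<And>x. x \<in> A \<Longrightarrow> (\<Sum>y\<in>A. exp (- dist x y) * u y) = exp (- dist x z)"
    using insert.IH[of "\<lambda>x. exp (- dist x z)"] by blast
  define s where "s = 1 - (\<Sum>y\<in>A. exp (- dist z y) * u y)"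
  have "s \<noteq> 0"
  proof
    assume s: "s = 0"
    define v where "v = (\<lambda>x. if x = z then 1 else - u x)"
    have vA: "v y = - u y" if "y \<in> A" for y using that insert.hyps by (auto simp: v_def)
    have "(\<Sum>y\<in>insert z A. v y * exp (- dist x y)) = 0" if "x \<in> insert z A" for x
    proof -
      have "(\<Sum>y\<in>insert z A. v y * exp (- dist x y))
          = exp (- dist x z) - (\<Sum>y\<in>A. exp (- dist x y) * u y)"
        using insert.hyps by (simp add: vA sum_negf mult.commute cong: sum.cong) (simp add: v_def)
      then show ?thesis using that u s by (auto simp: s_def)
    qed
    then have "(\<Sum>x\<in>insert z A. \<Sum>y\<in>insert z A. v x * v y * exp (- dist x y)) = 0"
      by (simp only: mult.assoc sum_distrib_left[symmetric]) simp
    from energy_zero_imp_zero[OF _ this, of z] show False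
      using insert.hyps by (simp add: v_def)
  qed
  define c where "c = (g z - (\<Sum>y\<in>A. exp (- dist z y) * w0 y)) / s"
  define w where "w = (\<lambda>x. if x = z then c else w0 x - c * u x)"
  have "(\<Sum>y\<in>insert z A. exp (- dist x y) * w y)
      = c * exp (- dist x z) + (\<Sum>y\<in>A. exp (- dist x y) * w0 y) - c * (\<Sum>y\<in>A. exp (- dist x y) * u y)" for x
  proof -
    have "(\<Sum>y\<in>A. exp (- dist x y) * w y) = (\<Sum>y\<in>A. exp (- dist x y) * (w0 y - c * u y))"
      using insert.hyps by (intro sum.cong) (auto simp: w_def)
    then show ?thesis using insert.hyps
      by (simp add: w_def algebra_simps sum_subtractf sum_distrib_left)
  qed
  note eq = this
  have "(\<Sum>y\<in>insert z A. exp (- dist x y) * w y) = g x" if "x \<in> insert z A" for x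
  proof (cases "x = z")
    case True
    have "c * s = g z - (\<Sum>y\<in>A. exp (- dist z y) * w0 y)" using \<open>s \<noteq> 0\<close> by (simp add: c_def)
    then show ?thesis unfolding eq True by (simp add: s_def algebra_simps)
  next
    case False
    then show ?thesis unfolding eq using that w0 u by simp
  qed
  then show ?case by blast
qed

lemma weighting_exists:
  fixes A :: "'a::euclidean_space set"
  assumes "finite A"
  obtains w where "weighting A w"
  using kernel_system_solvable[OF assms, of "\<lambda>_. 1"] unfolding weighting_def by blast

lemma weighting_energy:
  assumes "weighting A w"
  shows "(\<Sum>x\<in>A. \<Sum>y\<in>A. w x * w y * exp (- dist x y)) = sum w A"
proof -
  have "(\<Sum>x\<in>A. \<Sum>y\<in>A. w x * w y * exp (- dist x y)) = (\<Sum>x\<in>A. w x * (\<Sum>y\<in>A. exp (- dist x y) * w y))"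
    by (simp add: sum_distrib_left mult_ac)
  also have "\<dots> = sum w A"
    using assms by (intro sum.cong refl) (simp add: weighting_def)
  finally show ?thesis .
qed

text \<open>By duality it suffices to have finitely supported charges on \<open>X\<close> whose potential tends to 1
  pointwise on \<open>X\<close> and whose energy and total charge have the same limit.\<close>

lemma magnitude_eqI:
  fixes X :: "'a::euclidean_space set" and I :: "nat \<Rightarrow> 'i set" and p :: "nat \<Rightarrow> 'i \<Rightarrow> 'a"
  assumes fin: "\<And>n. finite (I n)" and p: "\<And>n i. i \<in> I n \<Longrightarrow> p n i \<in> X"
    and pot: "\<And>x. x \<in> X \<Longrightarrow> (\<lambda>n. \<Sum>i\<in>I n. v n i * exp (- dist x (p n i))) \<longlonglongrightarrow> 1"
    and energy: "(\<lambda>n. \<Sum>i\<in>I n. \<Sum>j\<in>I n. v n i * v n j * exp (- dist (p n i) (p n j))) \<longlonglongrightarrow> M"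
    and mass: "(\<lambda>n. \<Sum>i\<in>I n. v n i) \<longlonglongrightarrow> M"
    and "M > 0"
  shows "magnitude X = ereal M"
proof -
  define E where "E n = (\<Sum>i\<in>I n. \<Sum>j\<in>I n. v n i * v n j * exp (- dist (p n i) (p n j)))" for n
  \<comment> \<open>On the finite set \<open>A\<close> the potentials tend to 1, so pairing the
    charges with a weighting \<open>w\<close> of \<open>A\<close> tends to the total of
    \<open>w\<close>. This total is also the energy of \<open>w\<close>, and Cauchy-Schwarz compares
    its square with itself times \<open>M\<close>.\<close>
  have upper: "finite_magnitude A \<le> M" if A: "finite A" "A \<subseteq> X" for A
  proof -
    obtain w where w: "weighting A w" using weighting_exists[OF A(1)] .
    have "(\<lambda>n. \<Sum>x\<in>A. w x * (\<Sum>i\<in>I n. v n i * exp (- dist x (p n i)))) \<longlonglongrightarrow> (\<Sum>x\<in>A. w x * 1)"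
      using A by (intro tendsto_intros pot) auto
    then have "(\<lambda>n. (\<Sum>x\<in>A. \<Sum>i\<in>I n. w x * v n i * exp (- dist x (p n i)))\<^sup>2) \<longlonglongrightarrow> (sum w A)\<^sup>2"
      by (intro tendsto_power) (simp add: sum_distrib_left mult_ac)
    moreover have "(\<lambda>n. sum w A * E n) \<longlonglongrightarrow> sum w A * M"
      unfolding E_def by (intro tendsto_intros energy)
    moreover have "(\<Sum>x\<in>A. \<Sum>i\<in>I n. w x * v n i * exp (- dist x (p n i)))\<^sup>2 \<le> sum w A * E n" for n
      using energy_Cauchy_Schwarz[OF A(1) fin, of w "v n" "\<lambda>x. x" "p n" n]
      by (simp add: weighting_energy[OF w] E_def)
    ultimately have "(sum w A)\<^sup>2 \<le> sum w A * M"
      by (intro LIMSEQ_le) auto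
    then have "sum w A \<le> M"
      using \<open>M > 0\<close> by (cases "sum w A > 0") (auto simp: power2_eq_square)
    then show ?thesis using finite_magnitude_eq[OF w] by simp
  qed
  \<comment> \<open>A weighting of the support has potential 1 at every charge, so its pairing with
    the charge is exactly the total charge.\<close>
  have lower: "(sum (v n) (I n))\<^sup>2 \<le> E n * finite_magnitude (p n ` I n)" for n
  proof -
    define A where "A = p n ` I n"
    have "finite A" using fin by (simp add: A_def)
    then obtain w where w: "weighting A w" using weighting_exists by blast
    have "(\<Sum>i\<in>I n. \<Sum>y\<in>A. v n i * w y * exp (- dist (p n i) y)) = (\<Sum>i\<in>I n. v n i * (\<Sum>y\<in>A. exp (- dist (p n i) y) * w y))"
      by (simp add: sum_distrib_left mult_ac)
    also have "\<dots> = sum (v n) (I n)"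
      using w by (intro sum.cong refl) (simp add: weighting_def A_def)
    finally have "(sum (v n) (I n))\<^sup>2 \<le> E n * sum w A"
      using energy_Cauchy_Schwarz[OF fin[of n] \<open>finite A\<close>, where q = "\<lambda>x. x" and v = "v n" and p = "p n" and w = w]
      by (simp add: weighting_energy[OF w] E_def)
    then show ?thesis using finite_magnitude_eq[OF w] by (simp add: A_def)
  qed
  define S where "S = magnitude X"
  have "S \<le> ereal M"
    unfolding S_def magnitude_def by (rule SUP_least) (use upper in auto)
  moreover have "ereal M \<le> S"
  proof -
    have in_S: "ereal (finite_magnitude A) \<le> S" if "finite A" "A \<subseteq> X" for A
      unfolding S_def magnitude_def by (rule SUP_upper) (use that in auto)
    \<comment> \<open>The empty set contributes 0, which rules out minus infinity and makes the
      supremum a real number.\<close>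
    have "weighting {} (\<lambda>_::'a. 0)" by (simp add: weighting_def)
    from finite_magnitude_eq[OF this] in_S[of "{}"] have "0 \<le> S" by (simp add: zero_ereal_def)
    with \<open>S \<le> ereal M\<close> obtain s where s: "S = ereal s" by (cases S) auto
    have "(\<lambda>n. (sum (v n) (I n))\<^sup>2) \<longlonglongrightarrow> M\<^sup>2" by (intro tendsto_intros mass)
    moreover have "(\<lambda>n. E n * s) \<longlonglongrightarrow> M * s" unfolding E_def by (intro tendsto_intros energy)
    moreover have "(sum (v n) (I n))\<^sup>2 \<le> E n * s" for n
    proof -
      have "finite_magnitude (p n ` I n) \<le> s"
        using in_S[of "p n ` I n"] fin p by (auto simp: s)
      moreover have "0 \<le> E n" unfolding E_def by (rule energy_nonneg)
      ultimately show ?thesis using lower[of n] by (meson mult_left_mono order_trans)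
    qed
    ultimately have "M\<^sup>2 \<le> M * s" by (intro LIMSEQ_le) auto
    then show ?thesis using \<open>M > 0\<close> by (simp add: s power2_eq_square)
  qed
  ultimately show ?thesis by (simp add: S_def)
qed

section \<open>The radial problem\<close>

text \<open>Meant for functions of the absolute value, where each branch has a formula that extends
  smoothly past 0 and the two slopes at 0 coincide.\<close>

lemma DERIV_piecewise:
  fixes f g k :: "real \<Rightarrow> real"
  assumes f: "\<And>x. 0 \<le> x \<Longrightarrow> f x = g x" "\<And>x. x \<le> 0 \<Longrightarrow> f x = k x"
    and g: "0 \<le> t \<Longrightarrow> (g has_real_derivative D) (at t)"
    and k: "t \<le> 0 \<Longrightarrow> (k has_real_derivative D) (at t)"
  shows "(f has_real_derivative D) (at t)"
proof -
  have r: "(f has_real_derivative D) (at t within {0..})" if "0 \<le> t"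
    using has_field_derivative_at_within[OF g[OF that]]
    by (rule has_field_derivative_transform_within[where d = 1]) (use that f in auto)
  have l: "(f has_real_derivative D) (at t within {..0})" if "t \<le> 0"
    using has_field_derivative_at_within[OF k[OF that]]
    by (rule has_field_derivative_transform_within[where d = 1]) (use that f in auto)
  consider "t < 0" | "t = 0" | "t > 0" by linarith
  then show ?thesis
  proof cases
    case 1
    then have "at t within {..0} = at t" by (intro at_within_interior) auto
    with l 1 show ?thesis by simp
  next
    case 3
    then have "at t within {0..} = at t" by (intro at_within_interior) auto
    with r 3 show ?thesis by simp
  next
    case 2
    have "{..0} \<union> {0..} = (UNIV :: real set)" by auto
    moreover have "(f has_real_derivative D) (at t within {..0} \<union> {0..})"
      using l r 2 unfolding has_field_derivative_iff by (auto intro: Lim_Un)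
    ultimately show ?thesis by simp
  qed
qed

lemma abs_diff_le_of_DERIV_bound:
  fixes f :: "real \<Rightarrow> real"
  assumes "\<And>x. (f has_real_derivative f' x) (at x)" "\<And>x. \<bar>f' x\<bar> \<le> B"
  shows "\<bar>f x - f y\<bar> \<le> B * \<bar>x - y\<bar>"
  using field_differentiable_bound[of UNIV f f' B x y] assms by auto

text \<open>For t >= 0 this is minus an antiderivative of t * exp (- t), the integrand that appears
  when the kernel is averaged over a sphere by distance. It is the Matern covariance of smoothness
  3/2.\<close>

definition matern :: "real \<Rightarrow> real" where
  "matern t = (1 + \<bar>t\<bar>) * exp (- \<bar>t\<bar>)"

definition matern_deriv :: "real \<Rightarrow> real" where
  "matern_deriv t = - t * exp (- \<bar>t\<bar>)"

text \<open>The constants of integration make this antiderivative of \<open>matern\<close> odd and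
  the next one, \<open>matern_int2\<close>, even; hence \<open>radial_kernel_int\<close> vanishes at
  radius 0.\<close>

definition matern_int :: "real \<Rightarrow> real" where
  "matern_int t = (if t \<ge> 0 then 2 - (2 + t) * exp (- t) else - 2 + (2 - t) * exp t)"

definition matern_int2 :: "real \<Rightarrow> real" where
  "matern_int2 t = 2 * \<bar>t\<bar> + (3 + \<bar>t\<bar>) * exp (- \<bar>t\<bar>)"

lemma DERIV_matern: "(matern has_real_derivative matern_deriv t) (at t)"
  by (rule DERIV_piecewise[where g = "\<lambda>t. (1 + t) * exp (- t)" and k = "\<lambda>t. (1 - t) * exp t"])
     (auto simp: matern_def matern_deriv_def algebra_simps intro!: derivative_eq_intros)

lemma DERIV_matern_deriv: "(matern_deriv has_real_derivative (\<bar>t\<bar> - 1) * exp (- \<bar>t\<bar>)) (at t)"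
  by (rule DERIV_piecewise[where g = "\<lambda>t. - t * exp (- t)" and k = "\<lambda>t. - t * exp t"])
     (auto simp: matern_deriv_def algebra_simps intro!: derivative_eq_intros)

lemma DERIV_matern_int: "(matern_int has_real_derivative matern t) (at t)"
  by (rule DERIV_piecewise[where g = "\<lambda>t. 2 - (2 + t) * exp (- t)" and k = "\<lambda>t. - 2 + (2 - t) * exp t"])
     (auto simp: matern_int_def matern_def algebra_simps intro!: derivative_eq_intros)

lemma DERIV_matern_int2: "(matern_int2 has_real_derivative matern_int t) (at t)"
  by (rule DERIV_piecewise[where g = "\<lambda>t. 2 * t + (3 + t) * exp (- t)" and k = "\<lambda>t. - 2 * t + (3 - t) * exp t"])
     (auto simp: matern_int2_def matern_int_def algebra_simps intro!: derivative_eq_intros)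

lemma matern_bounds: "0 \<le> matern t" "matern t \<le> 1"
  using exp_ge_add_one_self[of "\<bar>t\<bar>"] by (auto simp: matern_def exp_minus field_simps)

lemma abs_matern_deriv_le: "\<bar>matern_deriv t\<bar> \<le> 1"
proof -
  have "\<bar>t\<bar> \<le> exp \<bar>t\<bar>" using exp_ge_add_one_self[of "\<bar>t\<bar>"] by linarith
  then show ?thesis by (simp add: matern_deriv_def exp_minus abs_mult field_simps)
qed

lemma abs_matern_deriv2_le: "\<bar>(\<bar>t\<bar> - 1) * exp (- \<bar>t\<bar>)\<bar> \<le> 1" for t :: real
proof -
  have "\<bar>(\<bar>t\<bar> - 1)\<bar> \<le> exp (\<bar>t\<bar>)" using exp_ge_add_one_self[of "\<bar>t\<bar>"] by linarith
  then show ?thesis by (simp add: abs_mult exp_minus field_simps)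
qed

lemma matern_lipschitz: "\<bar>matern x - matern y\<bar> \<le> \<bar>x - y\<bar>"
  using abs_diff_le_of_DERIV_bound[OF DERIV_matern abs_matern_deriv_le, of x y] by simp

lemma matern_deriv_lipschitz: "\<bar>matern_deriv x - matern_deriv y\<bar> \<le> \<bar>x - y\<bar>"
  using abs_diff_le_of_DERIV_bound[OF DERIV_matern_deriv abs_matern_deriv2_le, of x y] by simp

text \<open>\<open>radial_kernel r s\<close> is \<open>r * s\<close> times the average of \<open>exp (- dist x y)\<close> over \<open>y\<close> in
  a sphere of radius \<open>r\<close> centred at the origin, where \<open>norm x = s\<close>.\<close>

definition radial_kernel :: "real \<Rightarrow> real \<Rightarrow> real" where
  "radial_kernel r s = (matern (r - s) - matern (r + s)) / 2"

definition radial_kernel_deriv :: "real \<Rightarrow> real \<Rightarrow> real" where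
  "radial_kernel_deriv r s = (matern_deriv (r - s) - matern_deriv (r + s)) / 2"

definition radial_kernel_int :: "real \<Rightarrow> real \<Rightarrow> real" where
  "radial_kernel_int r s = (r * matern_int (r - s) - matern_int2 (r - s)
     - r * matern_int (r + s) + matern_int2 (r + s)) / 4"

lemma DERIV_radial_kernel:
  "((\<lambda>r. radial_kernel r s) has_real_derivative radial_kernel_deriv r s) (at r)"
  unfolding radial_kernel_def radial_kernel_deriv_def
  by (auto intro!: derivative_eq_intros DERIV_chain2[OF DERIV_matern])

lemma DERIV_radial_kernel_int:
  "((\<lambda>r. radial_kernel_int r s) has_real_derivative r / 2 * radial_kernel r s) (at r)"
  unfolding radial_kernel_def radial_kernel_int_def
  by (auto intro!: derivative_eq_intros DERIV_chain2[OF DERIV_matern_int] DERIV_chain2[OF DERIV_matern_int2]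
           simp: field_simps)

lemma radial_kernel_bounds:
  "\<bar>radial_kernel r s\<bar> \<le> 1"
  "\<bar>radial_kernel r s - radial_kernel r' s\<bar> \<le> \<bar>r - r'\<bar>"
  "\<bar>radial_kernel r s - radial_kernel r s'\<bar> \<le> \<bar>s - s'\<bar>"
  "\<bar>radial_kernel_deriv r s - radial_kernel_deriv r' s\<bar> \<le> \<bar>r - r'\<bar>"
  "\<bar>radial_kernel_deriv r s - radial_kernel_deriv r s'\<bar> \<le> \<bar>s - s'\<bar>"
proof -
  show "\<bar>radial_kernel r s\<bar> \<le> 1"
    using matern_bounds[of "r - s"] matern_bounds[of "r + s"] by (auto simp: radial_kernel_def)
  have half: "\<bar>(a - b) / 2 - (c - d) / 2\<bar> \<le> e" if "\<bar>a - c\<bar> \<le> e" "\<bar>b - d\<bar> \<le> e" for a b c d e :: real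
    using that by (auto simp: abs_le_iff field_simps)
  show "\<bar>radial_kernel r s - radial_kernel r' s\<bar> \<le> \<bar>r - r'\<bar>"
    unfolding radial_kernel_def by (intro half; rule order_trans[OF matern_lipschitz]; linarith)
  show "\<bar>radial_kernel r s - radial_kernel r s'\<bar> \<le> \<bar>s - s'\<bar>"
    unfolding radial_kernel_def by (intro half; rule order_trans[OF matern_lipschitz]; linarith)
  show "\<bar>radial_kernel_deriv r s - radial_kernel_deriv r' s\<bar> \<le> \<bar>r - r'\<bar>"
    unfolding radial_kernel_deriv_def by (intro half; rule order_trans[OF matern_deriv_lipschitz]; linarith)
  show "\<bar>radial_kernel_deriv r s - radial_kernel_deriv r s'\<bar> \<le> \<bar>s - s'\<bar>"
    unfolding radial_kernel_deriv_def by (intro half; rule order_trans[OF matern_deriv_lipschitz]; linarith)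
qed

lemma radial_kernel_int_0 [simp]: "radial_kernel_int 0 s = 0"
  by (simp add: radial_kernel_int_def matern_int2_def)

text \<open>The density \<open>r / 2\<close> on the whole half-line has potential \<open>s\<close>. The coefficients of the
  sphere and of its normal derivative are those that reproduce, for \<open>s \<le> R\<close>, the potential of
  the part of this density beyond \<open>R\<close>.\<close>

lemma radial_weighting_identity:
  assumes "0 \<le> s" "s \<le> R"
  shows "radial_kernel_int R s + (2 * R + 3) / 2 * radial_kernel R s
    + (R + 2) / 2 * radial_kernel_deriv R s = s"
proof -
  have "R - s \<ge> 0" "R + s \<ge> 0" using assms by auto
  then show ?thesis
    unfolding radial_kernel_int_def radial_kernel_def radial_kernel_deriv_def matern_def
      matern_deriv_def matern_int_def matern_int2_def
    by (simp add: field_simps)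
qed

section \<open>Discretisation of the radial charge\<close>

lemma left_riemann_sum_error:
  fixes f F :: "real \<Rightarrow> real" and n :: nat
  assumes F: "\<And>x. 0 \<le> x \<Longrightarrow> x \<le> R \<Longrightarrow> (F has_real_derivative f x) (at x)"
    and f: "\<And>x y. 0 \<le> x \<Longrightarrow> x \<le> y \<Longrightarrow> y \<le> R \<Longrightarrow> \<bar>f x - f y\<bar> \<le> L * (y - x)"
    and h: "h > 0" "real n * h = R" and "L \<ge> 0"
  shows "\<bar>(\<Sum>j<n. h * f (real j * h)) - (F R - F 0)\<bar> \<le> L * R * h"
proof -
  have step: "\<bar>h * f (j * h) - (F (Suc j * h) - F (j * h))\<bar> \<le> L * h\<^sup>2" if "j < n" for j
  proof -
    have le: "real (Suc j) * h \<le> R"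
      unfolding h(2)[symmetric] using that h(1) by (intro mult_right_mono) auto
    have lt: "real j * h < real (Suc j) * h" using h(1) by simp
    have j0: "0 \<le> real j * h" using h(1) by simp
    obtain z where z: "j * h < z" "z < Suc j * h" "F (Suc j * h) - F (j * h) = (Suc j * h - j * h) * f z"
      using MVT2[OF lt, of F f] F le j0 by (metis order_trans)
    have "h * f (j * h) - (F (Suc j * h) - F (j * h)) = h * (f (j * h) - f z)"
      unfolding z(3) by (simp add: algebra_simps)
    then have "\<bar>h * f (j * h) - (F (Suc j * h) - F (j * h))\<bar> = h * \<bar>f (j * h) - f z\<bar>"
      using h(1) by (simp add: abs_mult)
    also have "\<dots> \<le> h * (L * (z - j * h))"
      using h(1) z le j0 by (intro mult_left_mono f) auto
    also have "\<dots> \<le> h * (L * h)"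
      using z h(1) \<open>L \<ge> 0\<close> by (intro mult_left_mono) (auto simp: algebra_simps)
    finally show ?thesis by (simp add: power2_eq_square mult_ac)
  qed
  have "F R - F 0 = (\<Sum>j<n. F (Suc j * h) - F (j * h))"
    using sum_lessThan_telescope[of "\<lambda>j. F (real j * h)" n] h(2) by simp
  then have "\<bar>(\<Sum>j<n. h * f (j * h)) - (F R - F 0)\<bar> = \<bar>\<Sum>j<n. h * f (j * h) - (F (Suc j * h) - F (j * h))\<bar>"
    by (simp add: sum_subtractf)
  also have "\<dots> \<le> (\<Sum>j<n. L * h\<^sup>2)"
    by (rule order_trans[OF sum_abs sum_mono]) (use step in auto)
  also have "\<dots> = L * R * h" unfolding h(2)[symmetric] by (simp add: power2_eq_square)
  finally show ?thesis .
qed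

text \<open>A weight b at radius r stands for the total charge b * r spread evenly over the sphere
  of radius r. Thus \<open>\<lambda>r. r\<close> is sent to the total charge, and
  \<open>\<lambda>r. radial_kernel r s\<close> to s times the potential at distance s. The
  difference quotient is backward to keep every node inside the ball.\<close>

definition radial_sum :: "real \<Rightarrow> nat \<Rightarrow> (real \<Rightarrow> real) \<Rightarrow> real" where
  "radial_sum R n f = (let h = R / Suc n in
     (\<Sum>j<Suc n. h * (j * h / 2 * f (j * h))) + (2 * R + 3) / 2 * f R
       + (R + 2) / 2 * ((f R - f (R - h)) / h))"

lemma radial_sum_weighted_error:
  fixes f :: "real \<Rightarrow> real" and h :: real
  assumes F: "\<And>x. 0 \<le> x \<Longrightarrow> x \<le> R \<Longrightarrow> (F has_real_derivative x / 2 * f x) (at x)"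
    and f: "\<And>x. 0 \<le> x \<Longrightarrow> x \<le> R \<Longrightarrow> \<bar>f x\<bar> \<le> B"
       "\<And>x y. 0 \<le> x \<Longrightarrow> x \<le> y \<Longrightarrow> y \<le> R \<Longrightarrow> \<bar>f x - f y\<bar> \<le> K * (y - x)"
    and "R > 0" "K \<ge> 0" "h = R / Suc n"
  shows "\<bar>(\<Sum>j<Suc n. h * (j * h / 2 * f (j * h))) - (F R - F 0)\<bar> \<le> (R * K + B) / 2 * R * h"
proof (rule left_riemann_sum_error)
  have B: "0 \<le> B" using f(1)[of 0] \<open>R > 0\<close> by auto
  show "h > 0" "real (Suc n) * h = R" "(R * K + B) / 2 \<ge> 0" using assms B by auto
  fix x y assume xy: "0 \<le> x" "x \<le> y" "y \<le> R"
  have "\<bar>x / 2 * f x - y / 2 * f y\<bar> = \<bar>x * (f x - f y) - (y - x) * f y\<bar> / 2"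
    by (simp add: algebra_simps flip: diff_divide_distrib)
  also have "\<dots> \<le> (x * \<bar>f x - f y\<bar> + (y - x) * \<bar>f y\<bar>) / 2"
    using xy abs_triangle_ineq4[of "x * (f x - f y)" "(y - x) * f y"] by (simp add: abs_mult)
  also have "\<dots> \<le> (R * (K * (y - x)) + (y - x) * B) / 2"
    using xy f \<open>K \<ge> 0\<close> by (intro divide_right_mono add_mono mult_mono) auto
  finally show "\<bar>x / 2 * f x - y / 2 * f y\<bar> \<le> (R * K + B) / 2 * (y - x)"
    by (simp add: algebra_simps)
qed (use F in auto)

lemma mesh_tendsto_0: "(\<lambda>n. C * (R / real (Suc n))) \<longlonglongrightarrow> 0"
  using tendsto_mult_left[OF LIMSEQ_Suc[OF lim_const_over_n[of R]], of C] by simp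

lemma mesh_tendsto_at_right:
  assumes "R > 0" shows "filterlim (\<lambda>n. R / real (Suc n)) (at_right 0) sequentially"
  using mesh_tendsto_0[of 1 R] assms by (intro tendsto_imp_filterlim_at_right) auto

lemma radial_sum_tendsto:
  fixes f :: "real \<Rightarrow> real"
  assumes F: "\<And>x. 0 \<le> x \<Longrightarrow> x \<le> R \<Longrightarrow> (F has_real_derivative x / 2 * f x) (at x)"
    and f: "\<And>x. 0 \<le> x \<Longrightarrow> x \<le> R \<Longrightarrow> \<bar>f x\<bar> \<le> B"
       "\<And>x y. 0 \<le> x \<Longrightarrow> x \<le> y \<Longrightarrow> y \<le> R \<Longrightarrow> \<bar>f x - f y\<bar> \<le> K * (y - x)"
    and "R > 0" "K \<ge> 0" and D: "(f has_real_derivative D) (at R)"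
  shows "(\<lambda>n. radial_sum R n f) \<longlonglongrightarrow> F R - F 0 + (2 * R + 3) / 2 * f R + (R + 2) / 2 * D"
proof -
  have "(\<lambda>n. (\<Sum>j<Suc n. R / Suc n * (j * (R / Suc n) / 2 * f (j * (R / Suc n))))) \<longlonglongrightarrow> F R - F 0"
    using radial_sum_weighted_error[OF F f \<open>R > 0\<close> \<open>K \<ge> 0\<close> refl]
    by (intro LIM_zero_cancel[OF Lim_null_comparison[OF _ mesh_tendsto_0[of "(R * K + B) / 2 * R" R]]]) auto
  moreover have "(\<lambda>n. (f R - f (R - R / Suc n)) / (R / Suc n)) \<longlonglongrightarrow> D"
  proof -
    have "((\<lambda>h. (f (R + h) - f R) / h) \<longlongrightarrow> D) (at 0)" using D by (simp add: DERIV_def)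
    moreover have "filterlim (\<lambda>n. - (R / real (Suc n))) (at 0) sequentially"
      using tendsto_minus[OF mesh_tendsto_0[of 1 R]] \<open>R > 0\<close> by (intro filterlim_atI) auto
    ultimately have "(\<lambda>n. (f (R + - (R / real (Suc n))) - f R) / - (R / real (Suc n))) \<longlonglongrightarrow> D"
      by (rule filterlim_compose)
    moreover have "(f (R + - h) - f R) / - h = (f R - f (R - h)) / h" for h
      by (cases "h = 0") (simp_all add: field_simps)
    ultimately show ?thesis by (simp only:)
  qed
  ultimately show ?thesis
    unfolding radial_sum_def Let_def by (intro tendsto_intros)
qed

lemma radial_sum_id:
  assumes "R > 0"
  shows "(\<lambda>n. radial_sum R n (\<lambda>r. r)) \<longlonglongrightarrow> R ^ 3 / 6 + R\<^sup>2 + 2 * R + 1"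
proof -
  have "(\<lambda>n. radial_sum R n (\<lambda>r. r)) \<longlonglongrightarrow> R ^ 3 / 6 - 0 ^ 3 / 6 + (2 * R + 3) / 2 * R + (R + 2) / 2 * 1"
    by (rule radial_sum_tendsto[where B = R and K = 1])
       (use assms in \<open>auto intro!: derivative_eq_intros simp: power2_eq_square\<close>)
  also have "R ^ 3 / 6 - 0 ^ 3 / 6 + (2 * R + 3) / 2 * R + (R + 2) / 2 * 1 = R ^ 3 / 6 + R\<^sup>2 + 2 * R + 1"
    by (simp add: field_simps power2_eq_square)
  finally show ?thesis .
qed

text \<open>At the centre, s times the potential is 0 for every charge and carries no information.
  The potential itself is needed, and there a unit weight at radius r contributes r * exp (-
  r).\<close>

lemma radial_sum_centre:
  assumes "R > 0"
  shows "(\<lambda>n. radial_sum R n (\<lambda>r. r * exp (- r))) \<longlonglongrightarrow> 1"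
proof -
  define F where "F r = - (r\<^sup>2 + 2 * r + 2) * exp (- r) / 2" for r :: real
  have D: "((\<lambda>r. r * exp (- r)) has_real_derivative (1 - x) * exp (- x)) (at x)" for x :: real
    by (auto intro!: derivative_eq_intros simp: algebra_simps)
  have "(\<lambda>n. radial_sum R n (\<lambda>r. r * exp (- r)))
      \<longlonglongrightarrow> F R - F 0 + (2 * R + 3) / 2 * (R * exp (- R)) + (R + 2) / 2 * ((1 - R) * exp (- R))"
  proof (rule radial_sum_tendsto[where B = 1 and K = 1])
    show "(F has_real_derivative x / 2 * (x * exp (- x))) (at x)" for x
      unfolding F_def by (auto intro!: derivative_eq_intros simp: field_simps power2_eq_square)
    show "\<bar>x * exp (- x)\<bar> \<le> 1" if "0 \<le> x" for x :: real
      using abs_matern_deriv_le[of x] that by (simp add: matern_deriv_def)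
    show "\<bar>x * exp (- x) - y * exp (- y)\<bar> \<le> 1 * (y - x)" if xy: "0 \<le> x" "x \<le> y" for x y :: real
    proof -
      have "\<bar>(1 - z) * exp (- z)\<bar> \<le> 1" if "z \<ge> 0" for z :: real
        using abs_matern_deriv2_le[of z] that by (simp add: abs_minus_commute abs_mult)
      then have "norm (x * exp (- x) - y * exp (- y)) \<le> 1 * norm (x - y)"
        by (intro field_differentiable_bound[of "{0..}" _ "\<lambda>z. (1 - z) * exp (- z)"])
           (use xy in \<open>auto intro!: has_field_derivative_at_within D\<close>)
      then show ?thesis using xy by simp
    qed
  qed (use assms D in auto)
  then show ?thesis by (simp add: F_def field_simps power2_eq_square)
qed

text \<open>The kernel and its derivative in \<open>r\<close> have Lipschitz constants independent
  of \<open>s\<close>, so the Riemann sum and the difference quotient both err by order h uniformly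
  in \<open>s\<close>.\<close>

lemma radial_sum_kernel_error:
  assumes "R > 0" "0 \<le> s" "s \<le> R"
  shows "\<bar>radial_sum R n (\<lambda>r. radial_kernel r s) - s\<bar> \<le> ((R + 1) / 2 * R + (R + 2) / 2) * (R / Suc n)"
proof -
  define h where "h = R / Suc n"
  have h: "h > 0" using assms by (simp add: h_def)
  have 1: "\<bar>(\<Sum>j<Suc n. h * (j * h / 2 * radial_kernel (j * h) s)) - (radial_kernel_int R s - radial_kernel_int 0 s)\<bar>
      \<le> (R * 1 + 1) / 2 * R * h"
  proof (rule radial_sum_weighted_error[where f = "\<lambda>r. radial_kernel r s"])
    show "((\<lambda>r. radial_kernel_int r s) has_real_derivative x / 2 * radial_kernel x s) (at x)" for x
      by (rule DERIV_radial_kernel_int)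
    show "\<bar>radial_kernel x s - radial_kernel y s\<bar> \<le> 1 * (y - x)" if "x \<le> y" for x y
      using radial_kernel_bounds(2)[of x s y] that by auto
  qed (use assms h_def in \<open>auto intro!: radial_kernel_bounds(1)\<close>)
  obtain z where z: "R - h < z" "z < R" "radial_kernel R s - radial_kernel (R - h) s = (R - (R - h)) * radial_kernel_deriv z s"
    using MVT2[of "R - h" R "\<lambda>r. radial_kernel r s" "\<lambda>r. radial_kernel_deriv r s"] h DERIV_radial_kernel by auto
  then have 2: "(radial_kernel R s - radial_kernel (R - h) s) / h = radial_kernel_deriv z s" using h by simp
  have 3: "\<bar>radial_kernel_deriv z s - radial_kernel_deriv R s\<bar> \<le> h"
    using radial_kernel_bounds(4)[of z s R] z by auto
  have aux: "S + a * k + b * x - s = (S - (i - 0)) + b * (x - y)" if "i + a * k + b * y = s"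
    for S a k b x i y :: real
    using that by (simp add: algebra_simps)
  have "radial_sum R n (\<lambda>r. radial_kernel r s) - s
      = ((\<Sum>j<Suc n. h * (j * h / 2 * radial_kernel (j * h) s)) - (radial_kernel_int R s - radial_kernel_int 0 s))
        + (R + 2) / 2 * (radial_kernel_deriv z s - radial_kernel_deriv R s)"
    unfolding radial_sum_def Let_def h_def[symmetric] 2 radial_kernel_int_0
    by (rule aux) (rule radial_weighting_identity[OF assms(2,3)])
  also have "\<bar>\<dots>\<bar> \<le> (R * 1 + 1) / 2 * R * h + (R + 2) / 2 * h"
    using \<open>R > 0\<close> by (intro order_trans[OF abs_triangle_ineq add_mono[OF 1]])
      (simp add: abs_mult mult_left_mono[OF 3])
  finally show ?thesis by (simp add: h_def algebra_simps)
qed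

text \<open>Both quotients tend to the mixed second derivative of \<open>radial_kernel\<close> at
  (R, R): the first is a second difference of the kernel, the second a difference quotient in s of
  its r-derivative. The diagonal does no harm because \<open>matern\<close> is twice continuously
  differentiable.\<close>

lemma second_difference_limit:
  fixes R :: real
  assumes "R > 0"
  shows "((\<lambda>h. (radial_kernel R R - radial_kernel (R - h) R - (radial_kernel R (R - h) - radial_kernel (R - h) (R - h))) / h\<^sup>2
      - (radial_kernel_deriv R R - radial_kernel_deriv R (R - h)) / h) \<longlongrightarrow> 0) (at_right 0)"
proof -
  define c where "c = exp (- 2 * R)"
  \<comment> \<open>\<open>a\<close> comes from the terms in r - s of the second difference,
    \<open>b\<close> and \<open>d\<close> from those in r + s, which all carry the factor
    \<open>c\<close>; \<open>e\<close> and \<open>f\<close> belong to the derivative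
    quotient.\<close>
  have a: "((\<lambda>h::real. (1 - (1 + h) * exp (- h)) / h\<^sup>2) \<longlongrightarrow> 1 / 2) (at_right 0)" by real_asymp
  have b: "((\<lambda>h::real. (1 - 2 * exp h + exp (2 * h)) / h\<^sup>2) \<longlongrightarrow> 1) (at_right 0)" by real_asymp
  have d: "((\<lambda>h::real. (2 * h * exp h - 2 * h * exp (2 * h)) / h\<^sup>2) \<longlongrightarrow> - 2) (at_right 0)" by real_asymp
  have e: "((\<lambda>h::real. (1 - exp h) / h) \<longlongrightarrow> - 1) (at_right 0)" by real_asymp
  have f: "((\<lambda>h::real. exp (- h)) \<longlongrightarrow> 1) (at_right 0)" "((\<lambda>h::real. exp h) \<longlongrightarrow> 1) (at_right 0)" by real_asymp+
  have lim: "((\<lambda>h. ((1 - (1 + h) * exp (- h)) / h\<^sup>2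
        - c * ((1 + 2 * R) * ((1 - 2 * exp h + exp (2 * h)) / h\<^sup>2) + (2 * h * exp h - 2 * h * exp (2 * h)) / h\<^sup>2) / 2)
        - (2 * R * c * ((1 - exp h) / h) + exp (- h) + c * exp h) / 2)
      \<longlongrightarrow> (1 / 2 - c * ((1 + 2 * R) * 1 + - 2) / 2) - (2 * R * c * - 1 + 1 + c * 1) / 2) (at_right 0)"
    by (intro tendsto_intros a b d e f) auto
  have "\<forall>\<^sub>F h in at_right 0.
      ((1 - (1 + h) * exp (- h)) / h\<^sup>2
        - c * ((1 + 2 * R) * ((1 - 2 * exp h + exp (2 * h)) / h\<^sup>2) + (2 * h * exp h - 2 * h * exp (2 * h)) / h\<^sup>2) / 2)
        - (2 * R * c * ((1 - exp h) / h) + exp (- h) + c * exp h) / 2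
    = (radial_kernel R R - radial_kernel (R - h) R - (radial_kernel R (R - h) - radial_kernel (R - h) (R - h))) / h\<^sup>2
      - (radial_kernel_deriv R R - radial_kernel_deriv R (R - h)) / h"
  proof (rule eventually_at_rightI[of 0 R])
    fix h assume h: "h \<in> {0<..<R}"
    define g where "g = exp h"
    have g: "exp h = g" "exp (2 * h) = g\<^sup>2" by (simp_all add: g_def flip: exp_double)
    have m: "matern (R - R) = 1" "matern (R - h - (R - h)) = 1"
      "matern (R + R) = (1 + 2 * R) * c"
      "matern (R - h - R) = (1 + h) * exp (- h)" "matern (R - (R - h)) = (1 + h) * exp (- h)"
      "matern (R - h + R) = (1 + 2 * R - h) * (c * g)" "matern (R + (R - h)) = (1 + 2 * R - h) * (c * g)"
      "matern (R - h + (R - h)) = (1 + 2 * R - 2 * h) * (c * g\<^sup>2)"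
      "matern_deriv (R - R) = 0" "matern_deriv (R + R) = - 2 * R * c"
      "matern_deriv (R - (R - h)) = - h * exp (- h)" "matern_deriv (R + (R - h)) = - (2 * R - h) * (c * g)"
      using h unfolding matern_def matern_deriv_def c_def g_def exp_double[symmetric] exp_add[symmetric]
      by (simp_all add: algebra_simps)
    show "((1 - (1 + h) * exp (- h)) / h\<^sup>2
        - c * ((1 + 2 * R) * ((1 - 2 * exp h + exp (2 * h)) / h\<^sup>2) + (2 * h * exp h - 2 * h * exp (2 * h)) / h\<^sup>2) / 2)
        - (2 * R * c * ((1 - exp h) / h) + exp (- h) + c * exp h) / 2
    = (radial_kernel R R - radial_kernel (R - h) R - (radial_kernel R (R - h) - radial_kernel (R - h) (R - h))) / h\<^sup>2
      - (radial_kernel_deriv R R - radial_kernel_deriv R (R - h)) / h"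
      unfolding radial_kernel_def radial_kernel_deriv_def m g
      using h by (simp add: divide_simps power2_eq_square) (simp add: algebra_simps)
  qed (use assms in auto)
  note Lim_transform_eventually[OF lim this]
  also have "(1 / 2 - c * ((1 + 2 * R) * 1 + - 2) / 2) - (2 * R * c * - 1 + 1 + c * 1) / 2 = 0"
    by (simp add: field_simps)
  finally show ?thesis .
qed

text \<open>The uniform error of order h is useless after division by h. Instead the divided error
  is computed from the functions \<open>g n\<close>, difference quotients of the kernel in s: for
  every n they are bounded by 1 and have Lipschitz constant 1, so their Riemann sums again err by
  order h. By \<open>radial_weighting_identity\<close> at R and R - h the surface term cancels, and
  the normal derivative leaves only \<open>e2\<close>.\<close>

lemma radial_sum_kernel_boundary:
  assumes "R > 0"
  shows "(\<lambda>n. (radial_sum R n (\<lambda>r. radial_kernel r R) - R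
      - (radial_sum R n (\<lambda>r. radial_kernel r (R - R / Suc n)) - (R - R / Suc n))) / (R / Suc n)) \<longlonglongrightarrow> 0"
proof -
  define h where "h n = R / Suc n" for n
  have h: "0 < h n" "h n \<le> R" for n using assms by (auto simp: h_def field_simps)
  define g where "g n r = (radial_kernel r R - radial_kernel r (R - h n)) / h n" for n r
  define e1 where "e1 n = (\<Sum>j<Suc n. h n * (j * h n / 2 * g n (j * h n)))
     - ((radial_kernel_int R R - radial_kernel_int R (R - h n)) / h n - (radial_kernel_int 0 R - radial_kernel_int 0 (R - h n)) / h n)" for n
  define e2 where "e2 n = (radial_kernel R R - radial_kernel (R - h n) R - (radial_kernel R (R - h n) - radial_kernel (R - h n) (R - h n))) / (h n)\<^sup>2
      - (radial_kernel_deriv R R - radial_kernel_deriv R (R - h n)) / h n" for n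
  have "\<bar>e1 n\<bar> \<le> (R * 1 + 1) / 2 * R * h n" for n
    unfolding e1_def
  proof (rule radial_sum_weighted_error)
    fix x y :: real
    show "((\<lambda>r. (radial_kernel_int r R - radial_kernel_int r (R - h n)) / h n) has_real_derivative x / 2 * g n x) (at x)"
      unfolding g_def using h(1)[of n]
      by (auto intro!: derivative_eq_intros DERIV_radial_kernel_int simp: algebra_simps diff_divide_distrib)
    show "\<bar>g n x\<bar> \<le> 1"
      using radial_kernel_bounds(3)[of x R "R - h n"] h[of n] by (auto simp: g_def)
    assume "x \<le> y"
    have "(g n has_real_derivative (radial_kernel_deriv r R - radial_kernel_deriv r (R - h n)) / h n) (at r)" for r
      unfolding g_def using h(1)[of n] by (auto intro!: derivative_eq_intros DERIV_radial_kernel)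
    moreover have "\<bar>(radial_kernel_deriv r R - radial_kernel_deriv r (R - h n)) / h n\<bar> \<le> 1" for r
      using radial_kernel_bounds(5)[of r R "R - h n"] h[of n] by auto
    ultimately have "\<bar>g n x - g n y\<bar> \<le> 1 * \<bar>x - y\<bar>"
      by (rule abs_diff_le_of_DERIV_bound)
    with \<open>x \<le> y\<close> show "\<bar>g n x - g n y\<bar> \<le> 1 * (y - x)" by simp
  qed (use assms in \<open>auto simp: h_def\<close>)
  then have 1: "e1 \<longlonglongrightarrow> 0"
    by (intro Lim_null_comparison[OF _ mesh_tendsto_0[of "(R * 1 + 1) / 2 * R" R]]) (auto simp: h_def)
  have 2: "e2 \<longlonglongrightarrow> 0"
    unfolding e2_def h_def by (rule filterlim_compose[OF second_difference_limit mesh_tendsto_at_right]) fact+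
  have eq: "(radial_sum R n (\<lambda>r. radial_kernel r R) - R
      - (radial_sum R n (\<lambda>r. radial_kernel r (R - h n)) - (R - h n))) / h n = e1 n + (R + 2) / 2 * e2 n" for n
  proof -
    let ?k = radial_kernel and ?d = radial_kernel_deriv and ?i = radial_kernel_int
    have S: "(\<Sum>j<Suc n. h n * (j * h n / 2 * g n (j * h n)))
      = ((\<Sum>j<Suc n. h n * (j * h n / 2 * ?k (j * h n) R)) - (\<Sum>j<Suc n. h n * (j * h n / 2 * ?k (j * h n) (R - h n)))) / h n"
      unfolding g_def sum_subtractf[symmetric] sum_divide_distrib by (intro sum.cong) (auto simp: algebra_simps diff_divide_distrib)
    have "R - (R - h n) = (?i R R - ?i R (R - h n)) + (2 * R + 3) / 2 * (?k R R - ?k R (R - h n))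
        + (R + 2) / 2 * (?d R R - ?d R (R - h n))"
      using radial_weighting_identity[of R R] radial_weighting_identity[of "R - h n" R] h[of n] assms
      by (simp add: right_diff_distrib)
    note id = this
    have aux: "(S1 + a * k1 + b * ((k1 - k3) / H)) - R - ((S2 + a * k2 + b * ((k2 - k4) / H)) - (R - H))
        = H * (((S1 - S2) / H - ((i1 - i2) / H - (0 - 0) / H)) + b * ((k1 - k3 - (k2 - k4)) / H\<^sup>2 - (d1 - d2) / H))"
      if "H \<noteq> 0" "R - (R - H) = (i1 - i2) + a * (k1 - k2) + b * (d1 - d2)"
      for S1 S2 a b k1 k2 k3 k4 i1 i2 d1 d2 H :: real
    proof -
      have "H * (((S1 - S2) / H - ((i1 - i2) / H - (0 - 0) / H)) + b * ((k1 - k3 - (k2 - k4)) / H\<^sup>2 - (d1 - d2) / H))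
          = S1 - S2 - (i1 - i2) + b * ((k1 - k3) / H - (k2 - k4) / H) - b * (d1 - d2)"
        using that(1) by (simp add: field_simps power2_eq_square)
      then show ?thesis using that(2) by (simp add: algebra_simps)
    qed
    have "radial_sum R n (\<lambda>r. ?k r R) - R - (radial_sum R n (\<lambda>r. ?k r (R - h n)) - (R - h n))
      = h n * (e1 n + (R + 2) / 2 * e2 n)"
      unfolding e1_def e2_def S radial_sum_def Let_def h_def[symmetric] radial_kernel_int_0
      by (rule aux[OF _ id]) (use h(1)[of n] in simp)
    then show ?thesis using h(1)[of n] by simp
  qed
  have "(\<lambda>n. e1 n + (R + 2) / 2 * e2 n) \<longlonglongrightarrow> 0 + (R + 2) / 2 * 0"
    by (intro tendsto_intros 1 2)
  then show ?thesis unfolding eq[symmetric] by (simp add: h_def)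
qed

text \<open>The energy is the charge applied to its own potential. In the radial convention this
  potential is s + \<open>e n s\<close>; the part s yields the total charge, which is why both have
  the same limit. In the part \<open>e n\<close> the critical term is the quotient at the
  boundary.\<close>

lemma radial_energy_tendsto:
  assumes "R > 0"
  shows "(\<lambda>n. radial_sum R n (\<lambda>s. radial_sum R n (\<lambda>r. radial_kernel r s)))
    \<longlonglongrightarrow> R ^ 3 / 6 + R\<^sup>2 + 2 * R + 1"
proof -
  define h where "h n = R / Suc n" for n
  have h: "0 < h n" "h n \<le> R" for n using assms by (auto simp: h_def field_simps)
  define C where "C = (R + 1) / 2 * R + (R + 2) / 2"
  define e where "e n s = radial_sum R n (\<lambda>r. radial_kernel r s) - s" for n s
  have eb: "\<bar>e n s\<bar> \<le> C * h n" if "0 \<le> s" "s \<le> R" for n s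
    using radial_sum_kernel_error[OF assms that, of n] by (simp add: e_def C_def h_def)
  have C: "C \<ge> 0" using assms by (simp add: C_def)
  have sum0: "(\<lambda>n. \<Sum>j<Suc n. h n * (j * h n / 2 * e n (j * h n))) \<longlonglongrightarrow> 0"
  proof (rule Lim_null_comparison[OF always_eventually mesh_tendsto_0[of "R * (R / 2) * C" R]], rule allI)
    fix n
    have "norm (\<Sum>j<Suc n. h n * (j * h n / 2 * e n (j * h n))) \<le> (\<Sum>j<Suc n. h n * (R / 2 * (C * h n)))"
    proof (rule order_trans[OF norm_sum sum_mono])
      fix j assume "j \<in> {..<Suc n}"
      then have jh: "0 \<le> j * h n" "j * h n \<le> R"
        using assms mult_left_mono[of "real j" "1 + real n" R] by (auto simp: h_def field_simps)
      then have "norm (h n * (j * h n / 2 * e n (j * h n))) = h n * (j * h n / 2 * \<bar>e n (j * h n)\<bar>)"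
        using h[of n] by (simp add: abs_mult)
      also have "\<dots> \<le> h n * (R / 2 * (C * h n))"
        using h[of n] eb[OF jh] C jh by (intro mult_left_mono mult_mono divide_right_mono) auto
      finally show "norm (h n * (j * h n / 2 * e n (j * h n))) \<le> h n * (R / 2 * (C * h n))" .
    qed
    also have "\<dots> = (real (Suc n) * h n) * (R / 2) * C * h n" by simp
    also have "\<dots> = R * (R / 2) * C * (R / Suc n)" by (simp add: h_def)
    finally show "norm (\<Sum>j<Suc n. h n * (j * h n / 2 * e n (j * h n))) \<le> R * (R / 2) * C * (R / Suc n)" .
  qed
  have eR: "(\<lambda>n. e n R) \<longlonglongrightarrow> 0"
    by (rule Lim_null_comparison[OF always_eventually mesh_tendsto_0[of C R]])
       (use eb[of R] assms in \<open>auto simp: h_def\<close>)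
  have de: "(\<lambda>n. (e n R - e n (R - h n)) / h n) \<longlonglongrightarrow> 0"
    using radial_sum_kernel_boundary[OF assms] by (simp add: e_def h_def)
  have "(\<lambda>n. (\<Sum>j<Suc n. h n * (j * h n / 2 * e n (j * h n))) + (2 * R + 3) / 2 * e n R
       + (R + 2) / 2 * ((e n R - e n (R - h n)) / h n)) \<longlonglongrightarrow> 0 + (2 * R + 3) / 2 * 0 + (R + 2) / 2 * 0"
    by (intro tendsto_intros sum0 eR de)
  then have "(\<lambda>n. radial_sum R n (e n)) \<longlonglongrightarrow> 0"
    by (simp only: radial_sum_def Let_def h_def mult_zero_right add_0_right)
  from tendsto_add[OF this radial_sum_id[OF assms]]
  have "(\<lambda>n. radial_sum R n (e n) + radial_sum R n (\<lambda>r. r)) \<longlonglongrightarrow> R ^ 3 / 6 + R\<^sup>2 + 2 * R + 1" by simp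
  moreover have "radial_sum R n (\<lambda>s. u s + v s) = radial_sum R n u + radial_sum R n v" for u v n
    by (simp add: radial_sum_def Let_def algebra_simps sum.distrib diff_divide_distrib add_divide_distrib)
  note this[of _ "e _" "\<lambda>r. r", symmetric]
  ultimately show ?thesis by (simp add: e_def)
qed

section \<open>Averages over spheres\<close>

lemma lborel_distr_orthogonal:
  fixes f :: "real ^ 'n::{finite,wellorder} \<Rightarrow> real ^ 'n::_"
  assumes f: "orthogonal_transformation f"
  shows "distr lborel borel f = lborel"
proof (rule lborel_eqI[symmetric])
  fix l u :: "real ^ 'n::_" assume le: "\<And>b. b \<in> Basis \<Longrightarrow> l \<bullet> b \<le> u \<bullet> b"
  have [measurable]: "f \<in> borel_measurable borel"
    using orthogonal_transformation_linear[OF f]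
    by (intro borel_measurable_continuous_onI linear_continuous_on) (simp add: linear_conv_bounded_linear)
  define g where "g = inv f"
  have g: "orthogonal_transformation g" "f (g x) = x" "g (f x) = x" for x
    using orthogonal_transformation_bij[OF f] orthogonal_transformation_inv[OF f]
    by (simp_all add: g_def bij_is_surj bij_is_inj surj_f_inv_f)
  have eq: "f -` box l u = g ` box l u"
    proof (intro set_eqI iffI)
    fix x assume "x \<in> f -` box l u"
    then show "x \<in> g ` box l u" by (intro image_eqI[of _ _ "f x"]) (simp_all add: g)
  qed (auto simp: g(2))
  have "emeasure (distr lborel borel f) (box l u) = emeasure lborel (f -` box l u)"
    by (simp add: emeasure_distr)
  also have "\<dots> = emeasure lebesgue (f -` box l u)"
    using measurable_sets[of f borel borel "box l u"] by simp
  also have "\<dots> = emeasure lebesgue (g ` box l u)" by (simp only: eq)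
  also have "\<dots> = ennreal (measure lebesgue (g ` box l u))"
    by (intro emeasure_eq_measure2 measurable_orthogonal_image g) auto
  also have "\<dots> = ennreal (measure lebesgue (box l u))"
    by (simp add: measure_orthogonal_image g)
  also have "\<dots> = (\<Prod>b\<in>Basis. (u - l) \<bullet> b)"
    using le by (simp add: measure_lborel_box_eq)
  finally show "emeasure (distr lborel borel f) (box l u) = (\<Prod>b\<in>Basis. (u - l) \<bullet> b)" .
qed simp

text \<open>Volumes are to be found by slicing; with \<open>complex\<close> as the plane of the last
  two coordinates the slices are balls of known area.\<close>

lemma lborel_distr_split_coordinates:
  "distr lborel borel (\<lambda>v::real^3. (v $ 1, Complex (v $ 2) (v $ 3))) = lborel"
proof (rule lborel_eqI[symmetric])
  fix l u :: "real \<times> complex" assume le: "\<And>b. b \<in> Basis \<Longrightarrow> l \<bullet> b \<le> u \<bullet> b"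
  let ?T = "\<lambda>v::real^3. (v $ 1, Complex (v $ 2) (v $ 3))"
  have [measurable]: "?T \<in> borel_measurable borel"
    by (intro borel_measurable_continuous_onI) (auto simp: Complex_eq intro!: continuous_intros)
  have BP: "(Basis :: (real \<times> complex) set) = {(1, 0), (0, 1), (0, \<i>)}"
    by (auto simp: Basis_prod_def Basis_complex_def)
  have BV: "(Basis :: (real^3) set) = (\<lambda>i. axis i 1) ` UNIV" by (auto simp: Basis_vec_def)
  define l1 l2 l3 u1 u2 u3 where "l1 = fst l" "l2 = Re (snd l)" "l3 = Im (snd l)"
    and "u1 = fst u" "u2 = Re (snd u)" "u3 = Im (snd u)"
  then have lu: "l = (l1, Complex l2 l3)" "u = (u1, Complex u2 u3)"
    by (simp_all add: prod_eq_iff complex_eq_iff)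
  define l' u' :: "real^3" where "l' = vector [l1, l2, l3]" and "u' = vector [u1, u2, u3]"
  have le3: "l1 \<le> u1" "l2 \<le> u2" "l3 \<le> u3"
    using le[of "(1, 0)"] le[of "(0, 1)"] le[of "(0, \<i>)"] unfolding BP lu by (simp_all add: inner_complex_def)
  have eq: "?T -` box l u = box l' u'"
  proof (rule set_eqI)
    fix v :: "real^3"
    have "?T v \<in> box l u \<longleftrightarrow> l1 < v $ 1 \<and> v $ 1 < u1 \<and> l2 < v $ 2 \<and> v $ 2 < u2 \<and> l3 < v $ 3 \<and> v $ 3 < u3"
      unfolding box_def BP lu by (simp add: inner_complex_def)
    also have "\<dots> \<longleftrightarrow> v \<in> box l' u'"
      by (simp add: mem_box_cart forall_3 l'_def u'_def)
    finally show "v \<in> ?T -` box l u \<longleftrightarrow> v \<in> box l' u'" by simp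
  qed
  have le': "l' \<bullet> b \<le> u' \<bullet> b" if b: "b \<in> Basis" for b
  proof -
    obtain i where i: "b = axis i 1" using b unfolding BV by (rule imageE)
    consider "i = 1" | "i = 2" | "i = 3" using exhaust_3[of i] by blast
    then show ?thesis unfolding i by cases (use le3 in \<open>simp_all add: inner_axis l'_def u'_def\<close>)
  qed
  have inj: "inj (\<lambda>i::3. axis i (1::real))" by (auto simp: inj_def axis_eq_axis)
  have "emeasure (distr lborel borel ?T) (box l u) = emeasure lborel (?T -` box l u \<inter> space lborel)"
    by (rule emeasure_distr) simp_all
  also have "\<dots> = emeasure lborel (box l' u')" unfolding eq by simp
  also have "\<dots> = ennreal (\<Prod>b\<in>Basis. (u' - l') \<bullet> b)"
    by (rule emeasure_lborel_box) (rule le')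
  also have "(\<Prod>b\<in>Basis. (u' - l') \<bullet> b) = (u1 - l1) * (u2 - l2) * (u3 - l3)"
  proof -
    have "(\<Prod>b\<in>Basis. (u' - l') \<bullet> b) = (\<Prod>i\<in>UNIV. (u' - l') $ i)"
      unfolding BV by (subst prod.reindex[OF inj]) (simp add: inner_axis)
    also have "\<dots> = (u1 - l1) * (u2 - l2) * (u3 - l3)"
      by (simp only: UNIV_3) (simp add: l'_def u'_def)
    finally show ?thesis .
  qed
  also have "\<dots> = (\<Prod>b\<in>Basis. (u - l) \<bullet> b)"
    unfolding BP by (subst prod.insert) (simp_all add: lu inner_complex_def complex_eq_iff)
  finally show "emeasure (distr lborel borel ?T) (box l u) = (\<Prod>b\<in>Basis. (u - l) \<bullet> b)" .
qed simp

text \<open>The integrand is the squared radius of the slice at height \<open>a\<close> of the unit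
  ball intersected with the double cone \<open>t * norm y < \<bar>y $ 1\<bar>\<close>. Sphere and
  cone meet at |a| = t, where the integral is split.\<close>

lemma has_integral_slice_area:
  fixes t :: real
  assumes t: "0 < t" "t < 1"
  shows "((\<lambda>a. max 0 (min (1 - a\<^sup>2) (a\<^sup>2 * (1 / t\<^sup>2 - 1)))) has_integral 4 / 3 * (1 - t)) UNIV"
proof -
  let ?f = "\<lambda>a. max 0 (min (1 - a\<^sup>2) (a\<^sup>2 * (1 / t\<^sup>2 - 1)))"
  define k where "k = 1 / t\<^sup>2 - 1"
  have t2: "0 < t\<^sup>2" "t\<^sup>2 < 1" using t by (auto simp: power_less_one_iff)
  then have k: "k > 0" by (simp add: k_def)
  have cmp: "1 - a\<^sup>2 \<le> a\<^sup>2 * k \<longleftrightarrow> t\<^sup>2 \<le> a\<^sup>2" for a :: real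
    using t2 by (simp add: k_def field_simps)
  have out: "?f a = 1 - a\<^sup>2" if "t\<^sup>2 \<le> a\<^sup>2" "a\<^sup>2 \<le> 1" for a :: real
    using cmp[of a] that by (auto simp: k_def)
  have ins: "?f a = k * a\<^sup>2" if "a\<^sup>2 \<le> t\<^sup>2" for a :: real
  proof -
    have "a\<^sup>2 * k \<le> 1 - a\<^sup>2 " using cmp[of a] that by (cases "a\<^sup>2 = t\<^sup>2") (use t2 in \<open>auto simp: k_def field_simps\<close>)
    then show ?thesis using k by (auto simp: k_def mult.commute)
  qed
  have sq: "a\<^sup>2 \<le> t\<^sup>2 \<longleftrightarrow> \<bar>a\<bar> \<le> t" "a\<^sup>2 \<le> 1 \<longleftrightarrow> \<bar>a\<bar> \<le> 1" "t\<^sup>2 \<le> a\<^sup>2 \<longleftrightarrow> t \<le> \<bar>a\<bar>" for a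
    using t abs_le_square_iff[of a t] abs_le_square_iff[of t a] abs_le_square_iff[of a 1] by auto
  have FTC1: "((\<lambda>a. 1 - a\<^sup>2) has_integral (b - b ^ 3 / 3) - (c - c ^ 3 / 3)) {c..b}" if "c \<le> b" for b c :: real
    using that by (intro fundamental_theorem_of_calculus)
      (auto intro!: derivative_eq_intros simp flip: has_real_derivative_iff_has_vector_derivative)
  have FTC2: "((\<lambda>a. k * a\<^sup>2) has_integral k * b ^ 3 / 3 - k * c ^ 3 / 3) {c..b}" if "c \<le> b" for b c :: real
    using that by (intro fundamental_theorem_of_calculus)
      (auto intro!: derivative_eq_intros simp flip: has_real_derivative_iff_has_vector_derivative)
  have "(?f has_integral (- t - (- t) ^ 3 / 3) - (- 1 - (- 1) ^ 3 / 3)) {- 1..- t}"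
    by (intro has_integral_eq[OF out[symmetric] FTC1]) (use t in \<open>auto simp: sq\<close>)
  moreover have "(?f has_integral k * t ^ 3 / 3 - k * (- t) ^ 3 / 3) {- t..t}"
    by (intro has_integral_eq[OF ins[symmetric] FTC2]) (use t in \<open>auto simp: sq\<close>)
  moreover have "(?f has_integral (1 - 1 ^ 3 / 3) - (t - t ^ 3 / 3)) {t..1}"
    by (intro has_integral_eq[OF out[symmetric] FTC1]) (use t in \<open>auto simp: sq\<close>)
  ultimately have "(?f has_integral ((- t - (- t) ^ 3 / 3) - (- 1 - (- 1) ^ 3 / 3))
      + (k * t ^ 3 / 3 - k * (- t) ^ 3 / 3) + ((1 - 1 ^ 3 / 3) - (t - t ^ 3 / 3))) {- 1..1}"
    using t by (intro has_integral_combine[of "-1" t 1] has_integral_combine[of "-1" "-t" t]) auto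
  also have "((- t - (- t) ^ 3 / 3) - (- 1 - (- 1) ^ 3 / 3))
      + (k * t ^ 3 / 3 - k * (- t) ^ 3 / 3) + ((1 - 1 ^ 3 / 3) - (t - t ^ 3 / 3)) = 4 / 3 * (1 - t)"
    using t by (simp add: k_def field_simps power2_eq_square power3_eq_cube)
  finally show ?thesis
  proof (rule has_integral_on_superset)
    fix a :: real assume "a \<notin> {- 1..1}"
    then have "1 - a\<^sup>2 < 0" using sq(2)[of a] by auto
    then show "?f a = 0" by (simp add: max_def min_def)
  qed simp
qed

text \<open>This is Archimedes' theorem in solid form: the cones over the two polar caps above
  height \<open>t\<close> fill the fraction 1 - t of the ball.\<close>

lemma emeasure_double_cone:
  fixes t :: real
  assumes t: "0 < t" "t < 1"
  shows "emeasure lborel {y \<in> ball (0::real^3) 1. t * norm y < \<bar>y $ 1\<bar>} = ennreal (4 / 3 * pi * (1 - t))"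
proof -
  let ?T = "\<lambda>v::real^3. (v $ 1, Complex (v $ 2) (v $ 3))"
  have [measurable]: "?T \<in> borel_measurable borel"
    by (intro borel_measurable_continuous_onI) (auto simp: Complex_eq intro!: continuous_intros)
  define X where "X = {p :: real \<times> complex. (fst p)\<^sup>2 + (cmod (snd p))\<^sup>2 < 1
     \<and> t\<^sup>2 * ((fst p)\<^sup>2 + (cmod (snd p))\<^sup>2) < (fst p)\<^sup>2}"
  have "open X" unfolding X_def by (intro open_Collect_conj open_Collect_less continuous_intros)
  then have [measurable]: "X \<in> sets borel" by simp
  have n2: "(norm y)\<^sup>2 = (y $ 1)\<^sup>2 + ((y $ 2)\<^sup>2 + (y $ 3)\<^sup>2)" for y :: "real^3"
    by (simp add: norm_vec_def L2_set_def sum_3)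
  have eq: "{y \<in> ball (0::real^3) 1. t * norm y < \<bar>y $ 1\<bar>} = ?T -` X"
  proof -
    have "norm y < 1 \<longleftrightarrow> (norm y)\<^sup>2 < 1" for y :: "real^3"
      using abs_square_less_1[of "norm y"] by simp
    moreover have "t * norm y < \<bar>y $ 1\<bar> \<longleftrightarrow> t\<^sup>2 * (norm y)\<^sup>2 < (y $ 1)\<^sup>2" for y :: "real^3"
    proof -
      have "\<bar>t * norm y\<bar> = t * norm y" using t by simp
      then show ?thesis
        using abs_le_square_iff[of "y $ 1" "t * norm y"] by (metis not_le power_mult_distrib)
    qed
    ultimately show ?thesis
      unfolding X_def by (simp add: n2 cmod_power2 add.assoc vimage_def)
  qed
  have slice: "Pair a -` X = ball 0 (sqrt (min (1 - a\<^sup>2) (a\<^sup>2 * (1 / t\<^sup>2 - 1))))" for a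
  proof -
    have "cmod w < sqrt c \<longleftrightarrow> (cmod w)\<^sup>2 < c" for w c
      using real_sqrt_less_iff[of "(cmod w)\<^sup>2" c] by simp
    moreover have "t\<^sup>2 * (a\<^sup>2 + (cmod w)\<^sup>2) < a\<^sup>2 \<longleftrightarrow> (cmod w)\<^sup>2 < a\<^sup>2 * (1 / t\<^sup>2 - 1)" for w
      using t by (simp add: field_simps)
    ultimately show ?thesis by (auto simp: X_def)
  qed
  \<comment> \<open>For negative \<open>c\<close> the value of \<open>sqrt c\<close> is negative and
    the ball is empty, matching the area 0.\<close>
  have disc: "emeasure lborel (ball (0::complex) (sqrt c)) = ennreal (pi * max 0 c)" for c
  proof (cases "c \<ge> 0")
    case True
    then show ?thesis by (simp add: emeasure_ball unit_ball_vol_2 max_def)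
  next
    case False
    then have "ball (0::complex) (sqrt c) = {}" by (simp add: ball_eq_empty)
    then have "emeasure lborel (ball (0::complex) (sqrt c)) = 0" by (simp only: emeasure_empty)
    then show ?thesis using False by (simp add: max_def)
  qed
  have "emeasure lborel (?T -` X) = emeasure (distr lborel borel ?T) X"
    by (simp add: emeasure_distr)
  also have "\<dots> = emeasure (lborel \<Otimes>\<^sub>M lborel) X"
    by (simp add: lborel_distr_split_coordinates lborel_prod)
  also have "\<dots> = (\<integral>\<^sup>+a. emeasure lborel (Pair a -` X) \<partial>lborel)"
    by (rule lborel.emeasure_pair_measure_alt) (unfold lborel_prod, simp)
  also have "\<dots> = (\<integral>\<^sup>+a. ennreal (pi * max 0 (min (1 - a\<^sup>2) (a\<^sup>2 * (1 / t\<^sup>2 - 1)))) \<partial>lborel)"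
    by (simp only: slice disc)
  also have "\<dots> = ennreal (pi * (4 / 3 * (1 - t)))"
  proof (rule nn_integral_has_integral_lborel)
    show "((\<lambda>a. pi * max 0 (min (1 - a\<^sup>2) (a\<^sup>2 * (1 / t\<^sup>2 - 1)))) has_integral pi * (4 / 3 * (1 - t))) UNIV"
      by (intro has_integral_mult_right has_integral_slice_area t)
    show "(\<lambda>a. pi * max 0 (min (1 - a\<^sup>2) (a\<^sup>2 * (1 / t\<^sup>2 - 1)))) \<in> borel_measurable borel"
      by measurable
  qed simp
  finally show ?thesis unfolding eq by (simp only: mult_ac)
qed

text \<open>Takes the place of surface measure: the direction \<open>sgn y\<close> of a uniform
  random point of the ball has a rotation invariant law, and its heights can be read off from
  volumes. The centre, which has no direction, is a null set.\<close>

definition unit_ball_measure :: "(real ^ 3) measure" where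
  "unit_ball_measure = uniform_measure lborel (ball 0 1)"

lemma emeasure_unit_ball3: "emeasure lborel (ball (0::real^3) 1) = ennreal (4 / 3 * pi)"
  by (simp add: emeasure_ball unit_ball_vol_3)

lemma finite_measure_unit_ball_measure: "finite_measure unit_ball_measure"
  and measure_unit_ball_measure_UNIV: "measure unit_ball_measure UNIV = 1"
  and space_unit_ball_measure [simp]: "space unit_ball_measure = UNIV"
  and sets_unit_ball_measure [measurable_cong, simp]: "sets unit_ball_measure = sets borel"
proof -
  have 1: "emeasure unit_ball_measure UNIV = 1"
    unfolding unit_ball_measure_def
    by (subst emeasure_uniform_measure) (simp_all add: emeasure_unit_ball3 divide_ennreal)
  show sp: "space unit_ball_measure = UNIV" "sets unit_ball_measure = sets borel"
    by (simp_all add: unit_ball_measure_def)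
  show "finite_measure unit_ball_measure"
    by (rule finite_measureI) (simp add: 1 sp)
  show "measure unit_ball_measure UNIV = 1" by (simp add: measure_def 1)
qed

lemma unit_ball_measure_AE_nonzero: "AE y in unit_ball_measure. y \<noteq> 0"
proof -
  have "AE y in lborel. y \<noteq> (0::real^3)" by (rule AE_lborel_singleton)
  then show ?thesis unfolding unit_ball_measure_def
    by (intro AE_uniform_measureI) auto
qed

lemma unit_ball_measure_orthogonal:
  assumes f: "orthogonal_transformation f"
  shows "distr unit_ball_measure borel f = unit_ball_measure"
proof (rule measure_eqI)
  fix A assume "A \<in> sets (distr unit_ball_measure borel f)"
  then have [measurable]: "A \<in> sets borel" by simp
  have [measurable]: "f \<in> borel_measurable borel"
    using orthogonal_transformation_linear[OF f]
    by (intro borel_measurable_continuous_onI linear_continuous_on) (simp add: linear_conv_bounded_linear)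
  have A': "f -` A \<in> sets borel" using measurable_sets[of f borel borel A] by simp
  have n: "norm (f x) = norm x" for x using f orthogonal_transformation by blast
  have "emeasure (distr unit_ball_measure borel f) A = emeasure unit_ball_measure (f -` A)"
    by (subst emeasure_distr) auto
  also have "\<dots> = emeasure lborel (ball 0 1 \<inter> f -` A) / emeasure lborel (ball (0::real^3) 1)"
    unfolding unit_ball_measure_def using A' by (intro emeasure_uniform_measure) simp_all
  also have "ball 0 1 \<inter> f -` A = f -` (ball 0 1 \<inter> A) \<inter> space lborel"
    by (auto simp: n)
  also have "emeasure lborel \<dots> = emeasure (distr lborel borel f) (ball 0 1 \<inter> A)"
    by (rule emeasure_distr[symmetric]) auto
  also have "\<dots> / emeasure lborel (ball (0::real^3) 1) = emeasure unit_ball_measure A"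
    unfolding lborel_distr_orthogonal[OF f] unit_ball_measure_def
    by (intro emeasure_uniform_measure[symmetric]) simp_all
  finally show "emeasure (distr unit_ball_measure borel f) A = emeasure unit_ball_measure A" .
qed simp

text \<open>Archimedes' hat-box theorem, up to symmetry.\<close>

lemma distr_abs_coordinate:
  "distr unit_ball_measure borel (\<lambda>y. \<bar>y $ 1\<bar> / norm y) = density lborel (indicator {0..1})"
proof -
  interpret finite_measure unit_ball_measure by (rule finite_measure_unit_ball_measure)
  let ?z = "\<lambda>y::real^3. \<bar>y $ 1\<bar> / norm y"
  let ?M = "distr unit_ball_measure borel ?z"
  have [measurable]: "?z \<in> borel_measurable borel" by measurable
  have M: "emeasure ?M {t<..} = ennreal (measure unit_ball_measure {y. t < ?z y})" for t
    by (simp add: emeasure_distr emeasure_eq_measure vimage_def)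
  have z1: "?z y \<le> 1" for y using component_le_norm_cart[of y 1] by (simp add: divide_le_eq_1)
  have mid: "measure unit_ball_measure {y. t < ?z y} = 1 - t" if t: "0 < t" "t < 1" for t
  proof -
    have "ball 0 1 \<inter> {y. t < ?z y} = {y \<in> ball 0 1. t * norm y < \<bar>y $ 1\<bar>}"
      using t by (auto simp: field_simps less_divide_eq)
    moreover have "emeasure unit_ball_measure {y. t < ?z y}
        = emeasure lborel (ball 0 1 \<inter> {y. t < ?z y}) / emeasure lborel (ball (0::real^3) 1)"
      unfolding unit_ball_measure_def by (rule emeasure_uniform_measure) auto
    ultimately have "emeasure unit_ball_measure {y. t < ?z y} = ennreal (4 / 3 * pi * (1 - t)) / ennreal (4 / 3 * pi)"
      using t by (simp only: emeasure_double_cone emeasure_unit_ball3)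
    also have "\<dots> = ennreal (1 - t)" using t by (subst divide_ennreal) auto
    finally show ?thesis using t by (simp add: measure_def)
  qed
  have le1: "measure unit_ball_measure S \<le> 1" for S
    using bounded_measure[of S] by (simp add: measure_unit_ball_measure_UNIV)
  \<comment> \<open>The cone volume requires 0 < t; the case t = 0 follows by monotonicity from
    arbitrarily small t.\<close>
  have zero: "measure unit_ball_measure {y. 0 < ?z y} = 1"
  proof (rule antisym[OF le1 field_le_epsilon])
    fix e :: real assume "e > 0"
    define t where "t = min e (1/2)"
    have t: "0 < t" "t < 1" "t \<le> e" using \<open>e > 0\<close> by (auto simp: t_def)
    have "1 - t \<le> measure unit_ball_measure {y. 0 < ?z y}"
      unfolding mid[OF t(1,2), symmetric] using t by (intro finite_measure_mono) auto
    then show "1 \<le> measure unit_ball_measure {y. 0 < ?z y} + e" using t by simp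
  qed
  have main: "measure unit_ball_measure {y. t < ?z y} = (if t < 0 then 1 else if t < 1 then 1 - t else 0)" for t
  proof -
    consider "t < 0" | "t = 0" | "0 < t" "t < 1" | "1 \<le> t" by linarith
    then show ?thesis
    proof cases
      case 1
      then have "{y. t < ?z y} = UNIV" by (auto intro: less_le_trans)
      then show ?thesis using 1 by (simp add: measure_unit_ball_measure_UNIV)
    next
      case 4
      then have "{y. t < ?z y} = {}" using z1 by (auto simp: not_less intro: order_trans)
      then show ?thesis using 4 by simp
    qed (use mid zero in auto)
  qed
  show ?thesis
  proof (rule measure_eqI_lessThan)
    fix t :: real
    have "emeasure (density lborel (indicator {0..1})) {t<..} = emeasure lborel ({0..1} \<inter> {t<..})"
      by (simp add: emeasure_density flip: indicator_inter_arith)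
    also have "{0..1} \<inter> {t<..} = (if t < 0 then {0..1} else {t<..1})" by auto
    also have "emeasure lborel \<dots> = ennreal (if t < 0 then 1 else if t < 1 then 1 - t else 0)"
      by (auto simp: ennreal_neg)
    finally show "emeasure ?M {t<..} = emeasure (density lborel (indicator {0..1})) {t<..}"
      by (simp only: M main)
    show "emeasure ?M {t<..} < \<infinity>" by (simp only: M) simp
  qed simp_all
qed

text \<open>After a rotation of \<open>x\<close> to the first axis, the law of cosines makes the
  squared distance affine in the height z of the direction, which is uniformly distributed.
  Averaging thus integrates d * exp (- d) over the distances d between |r - s| and r + s, with
  antiderivative minus \<open>matern\<close>.\<close>

lemma sphere_average:
  fixes x :: "real ^ 3"
  assumes "r \<ge> 0"
  shows "norm x * r * (\<integral>y. exp (- dist x (r *\<^sub>R sgn y)) \<partial>unit_ball_measure) = radial_kernel r (norm x)"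
proof (cases "norm x * r = 0")
  case True
  then show ?thesis by (auto simp: radial_kernel_def matern_def)
next
  case False
  define s where "s = norm x"
  have sr: "s > 0" "r > 0" using False assms by (auto simp: s_def)
  interpret finite_measure unit_ball_measure by (rule finite_measure_unit_ball_measure)
  define \<Phi> where "\<Phi> z = exp (- sqrt (s\<^sup>2 + r\<^sup>2 - 2 * r * s * z))" for z
  define a :: "real^3" where "a = s *\<^sub>R axis 1 1"
  have na: "norm a = norm x" using sr by (simp add: a_def s_def)
  obtain f where f: "orthogonal_transformation f" "f a = x"
    using orthogonal_transformation_exists[OF na] by blast
  have meas: "g \<in> borel_measurable borel" if "orthogonal_transformation g" for g :: "real^3 \<Rightarrow> real^3"
    using orthogonal_transformation_linear[OF that]
    by (intro borel_measurable_continuous_onI linear_continuous_on) (simp add: linear_conv_bounded_linear)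
  note [measurable] = meas[OF f(1)]
  have rot: "(\<integral>y. h (g y) \<partial>unit_ball_measure) = (\<integral>y. h y \<partial>unit_ball_measure)"
    if "orthogonal_transformation g" "h \<in> borel_measurable borel" for g and h :: "real^3 \<Rightarrow> real"
  proof -
    have "(\<integral>y. h y \<partial>unit_ball_measure) = (\<integral>y. h y \<partial>distr unit_ball_measure borel g)"
      by (simp only: unit_ball_measure_orthogonal[OF that(1)])
    also have "\<dots> = (\<integral>y. h (g y) \<partial>unit_ball_measure)"
      using meas[OF that(1)] that(2) by (intro integral_distr) auto
    finally show ?thesis ..
  qed
  have [measurable]: "(sgn :: real^3 \<Rightarrow> real^3) \<in> borel_measurable borel"
    unfolding sgn_div_norm by measurable
  have dist_a: "exp (- dist a (r *\<^sub>R sgn y)) = \<Phi> (y $ 1 / norm y)" if "y \<noteq> 0" for y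
  proof -
    have "(dist a (r *\<^sub>R sgn y))\<^sup>2 = s\<^sup>2 + r\<^sup>2 - 2 * r * s * (y $ 1 / norm y)"
    proof -
      have "(dist a (r *\<^sub>R sgn y))\<^sup>2 = (norm a)\<^sup>2 + (norm (r *\<^sub>R sgn y))\<^sup>2 - 2 * (a \<bullet> (r *\<^sub>R sgn y))"
        unfolding dist_norm power2_norm_eq_inner by (simp add: inner_diff inner_commute)
      moreover have "norm (r *\<^sub>R sgn y) = r" using that sr by (simp add: norm_sgn)
      moreover have "a \<bullet> (r *\<^sub>R sgn y) = r * s * (y $ 1 / norm y)"
        by (simp add: a_def sgn_div_norm inner_axis' divide_inverse)
      ultimately show ?thesis by (simp add: na s_def)
    qed
    then have "dist a (r *\<^sub>R sgn y) = sqrt (s\<^sup>2 + r\<^sup>2 - 2 * r * s * (y $ 1 / norm y))"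
      by (metis real_sqrt_unique zero_le_dist)
    then show ?thesis by (simp add: \<Phi>_def)
  qed
  have [measurable]: "\<Phi> \<in> borel_measurable borel" unfolding \<Phi>_def by measurable
  have \<Phi>_bound: "norm (\<Phi> z) \<le> 1" if "\<bar>z\<bar> \<le> 1" for z
  proof -
    have "0 \<le> (s - r)\<^sup>2" by simp
    also have "\<dots> \<le> s\<^sup>2 + r\<^sup>2 - 2 * r * s * z"
      using that sr mult_left_mono[of z 1 "2 * r * s"] by (auto simp: power2_eq_square algebra_simps)
    finally show ?thesis by (simp add: \<Phi>_def)
  qed
  have z_le: "\<bar>y $ 1 / norm y\<bar> \<le> 1" for y :: "real^3"
    using component_le_norm_cart[of y 1] by (simp add: divide_le_eq_1)
  have int: "integrable unit_ball_measure (\<lambda>y. \<Phi> (c * (y $ 1 / norm y)))" if "\<bar>c\<bar> = 1" for c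
    by (rule integrable_const_bound[where B = 1])
       (use \<Phi>_bound z_le that in \<open>auto simp: abs_mult\<close>)
  \<comment> \<open>Only the law of the absolute height is available, so the integrand is made even
    by means of the reflection y -> -y.\<close>
  define \<psi> where "\<psi> z = (\<Phi> z + \<Phi> (- z)) / 2" for z
  have [measurable]: "\<psi> \<in> borel_measurable borel" unfolding \<psi>_def[abs_def] by measurable
  have "(\<integral>y. exp (- dist x (r *\<^sub>R sgn y)) \<partial>unit_ball_measure)
      = (\<integral>y. exp (- dist x (r *\<^sub>R sgn (f y))) \<partial>unit_ball_measure)"
    by (rule rot[OF f(1), symmetric, of "\<lambda>y. exp (- dist x (r *\<^sub>R sgn y))"]) measurable
  also have "\<dots> = (\<integral>y. exp (- dist a (r *\<^sub>R sgn y)) \<partial>unit_ball_measure)"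
  proof (rule Bochner_Integration.integral_cong[OF refl])
    fix y
    have lf: "linear f" using f(1) by (rule orthogonal_transformation_linear)
    have "dist x (r *\<^sub>R sgn (f y)) = norm (f (a - r *\<^sub>R sgn y))"
      using f orthogonal_transformation[of f]
      by (simp add: dist_norm sgn_div_norm linear_diff[OF lf] linear_cmul[OF lf])
    also have "\<dots> = dist a (r *\<^sub>R sgn y)"
      using f orthogonal_transformation[of f] by (simp add: dist_norm)
    finally show "exp (- dist x (r *\<^sub>R sgn (f y))) = exp (- dist a (r *\<^sub>R sgn y))" by simp
  qed
  also have "\<dots> = (\<integral>y. \<Phi> (y $ 1 / norm y) \<partial>unit_ball_measure)"
    by (intro integral_cong_AE) (use unit_ball_measure_AE_nonzero in \<open>auto simp: dist_a\<close>)
  finally have I1: "(\<integral>y. exp (- dist x (r *\<^sub>R sgn y)) \<partial>unit_ball_measure) = (\<integral>y. \<Phi> (y $ 1 / norm y) \<partial>unit_ball_measure)" .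
  have I2: "(\<integral>y. \<Phi> (y $ 1 / norm y) \<partial>unit_ball_measure) = (\<integral>y. \<Phi> (- (y $ 1 / norm y)) \<partial>unit_ball_measure)"
    using rot[of uminus "\<lambda>y. \<Phi> (- (y $ 1 / norm y))"]
    by (simp add: orthogonal_transformation linear_uminus)
  have "(\<integral>y. \<Phi> (y $ 1 / norm y) \<partial>unit_ball_measure) = (\<integral>y. \<psi> (y $ 1 / norm y) \<partial>unit_ball_measure)"
    unfolding \<psi>_def using int[of 1] int[of "-1"] I2 by simp
  also have "\<dots> = (\<integral>y. \<psi> (\<bar>y $ 1\<bar> / norm y) \<partial>unit_ball_measure)"
    by (intro Bochner_Integration.integral_cong refl) (auto simp: abs_if \<psi>_def)
  also have "\<dots> = (\<integral>z. \<psi> z \<partial>distr unit_ball_measure borel (\<lambda>y. \<bar>y $ 1\<bar> / norm y))"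
    by (subst integral_distr) auto
  also have "\<dots> = (\<integral>z. indicator {0..1} z *\<^sub>R \<psi> z \<partial>lborel)"
    unfolding distr_abs_coordinate
    using integral_density[of \<psi> lborel "indicator {0..1}"] by (simp add: ennreal_indicator)
  finally have I3: "(\<integral>y. \<Phi> (y $ 1 / norm y) \<partial>unit_ball_measure) = set_lebesgue_integral lborel {0..1} \<psi>"
    by (simp add: set_lebesgue_integral_def)
  define F where "F z = (matern (sqrt (s\<^sup>2 + r\<^sup>2 - 2 * r * s * z)) - matern (sqrt (s\<^sup>2 + r\<^sup>2 + 2 * r * s * z))) / 2" for z
  have matern_cont: "continuous_on UNIV matern"
    by (intro continuous_at_imp_continuous_on ballI DERIV_isCont[OF DERIV_matern])
  \<comment> \<open>Differentiability is checked in the interior only: for r = s the distance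
    vanishes at z = 1, where the square root has no derivative.\<close>
  have "((\<lambda>z. r * s * \<psi> z) has_integral F 1 - F 0) {0..1}"
  proof (rule fundamental_theorem_of_calculus_interior)
    show "continuous_on {0..1} F"
      unfolding F_def by (intro continuous_intros continuous_on_compose2[OF matern_cont]) auto
    fix z :: real assume z: "z \<in> {0<..<1}"
    have rsz: "r * s * z < r * s" "0 < r * s * z" using z sr by auto
    have "s\<^sup>2 + r\<^sup>2 - 2 * r * s * z = (s - r)\<^sup>2 + 2 * (r * s - r * s * z)"
      by (simp add: power2_eq_square algebra_simps)
    then have p1: "s\<^sup>2 + r\<^sup>2 - 2 * r * s * z > 0" using rsz(1) by (simp only:) (intro add_nonneg_pos; simp)
    have p2: "s\<^sup>2 + r\<^sup>2 + 2 * r * s * z > 0" using rsz(2) sr by (intro add_pos_pos) auto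
    note p = p1 p2
    have "(F has_real_derivative r * s * \<psi> z) (at z)"
      unfolding F_def using p
      by (auto intro!: derivative_eq_intros DERIV_chain2[OF DERIV_matern]
          simp: matern_deriv_def \<psi>_def \<Phi>_def field_simps)
    then show "(F has_vector_derivative r * s * \<psi> z) (at z)"
      by (simp add: has_real_derivative_iff_has_vector_derivative)
  qed simp
  moreover have "F 1 - F 0 = radial_kernel r s"
  proof -
    have "s\<^sup>2 + r\<^sup>2 - 2 * r * s * 1 = (r - s)\<^sup>2" "s\<^sup>2 + r\<^sup>2 + 2 * r * s * 1 = (r + s)\<^sup>2"
      by (simp_all add: power2_eq_square algebra_simps)
    then show ?thesis unfolding F_def radial_kernel_def using sr
      by (simp only: real_sqrt_abs) (simp add: matern_def)
  qed
  moreover have "set_integrable lborel {0..1} \<psi>"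
    unfolding \<psi>_def \<Phi>_def by (intro borel_integrable_atLeastAtMost' continuous_intros) auto
  then have "(\<psi> has_integral set_lebesgue_integral lborel {0..1} \<psi>) {0..1}"
    using has_integral_set_lebesgue[of "{0..1}" \<psi>] by (simp add: set_integrable_def set_lebesgue_integral_def integrable_completion integral_completion)
  then have "((\<lambda>z. r * s * \<psi> z) has_integral r * s * set_lebesgue_integral lborel {0..1} \<psi>) {0..1}"
    by (rule has_integral_mult_right)
  ultimately have "r * s * set_lebesgue_integral lborel {0..1} \<psi> = radial_kernel r s"
    using has_integral_unique by metis
  then show ?thesis unfolding I1 I3 s_def[symmetric] by (simp add: mult.commute)
qed

section \<open>Finitely supported approximations\<close>

text \<open>Greedy partition: each point of \<open>C\<close> in turn receives the mass of what is
  left of \<open>S\<close> in its ball. The weights are chosen before \<open>g\<close>, since one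
  quadrature must serve the kernel seen from every point and at every radius.\<close>

lemma lipschitz_quadrature:
  fixes M :: "'a::euclidean_space measure"
  assumes "finite_measure M" and [measurable_cong, simp]: "sets M = sets borel" and "finite C"
    and "S \<in> sets borel" "S \<subseteq> (\<Union>x\<in>C. ball x \<delta>)"
  shows "\<exists>p. (\<forall>x. 0 \<le> p x) \<and> sum p C = measure M S \<and>
    (\<forall>g L. g \<in> borel_measurable borel \<longrightarrow> (\<forall>x. \<bar>g x\<bar> \<le> 1) \<longrightarrow> 0 \<le> L \<longrightarrow>
      (\<forall>x y. \<bar>g x - g y\<bar> \<le> L * dist x y) \<longrightarrow>
      \<bar>set_lebesgue_integral M S g - (\<Sum>x\<in>C. p x * g x)\<bar> \<le> L * \<delta> * measure M S)"
  using assms(3-5)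
proof (induction C arbitrary: S rule: finite_induct)
  case empty
  then show ?case by (intro exI[of _ "\<lambda>_. 0"]) (auto simp: set_lebesgue_integral_def)
next
  case (insert c C)
  interpret finite_measure M by fact
  have [measurable]: "S \<in> sets borel" by fact
  define A B where "A = S \<inter> ball c \<delta>" and "B = S - ball c \<delta>"
  have [measurable]: "A \<in> sets borel" "B \<in> sets borel" by (auto simp: A_def B_def)
  have AB: "S = A \<union> B" "A \<inter> B = {}" by (auto simp: A_def B_def)
  have mS: "measure M S = measure M A + measure M B"
    unfolding AB(1) by (rule finite_measure_Union) (use AB in auto)
  have "B \<subseteq> (\<Union>x\<in>C. ball x \<delta>)" using insert.prems by (auto simp: B_def)
  from insert.IH[OF \<open>B \<in> sets borel\<close> this]
  obtain p where p: "\<forall>x. 0 \<le> p x" "sum p C = measure M B"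
    and err: "\<forall>g L. g \<in> borel_measurable borel \<longrightarrow> (\<forall>x. \<bar>g x\<bar> \<le> 1) \<longrightarrow> 0 \<le> L \<longrightarrow>
      (\<forall>x y. \<bar>g x - g y\<bar> \<le> L * dist x y) \<longrightarrow>
      \<bar>set_lebesgue_integral M B g - (\<Sum>x\<in>C. p x * g x)\<bar> \<le> L * \<delta> * measure M B"
    by (elim exE conjE) (rule that)
  define p' where "p' = p(c := measure M A)"
  have p'C: "(\<Sum>x\<in>C. p' x * f x) = (\<Sum>x\<in>C. p x * f x)" for f :: "'a \<Rightarrow> real"
    using insert.hyps by (intro sum.cong) (auto simp: p'_def)
  show ?case
  proof (intro exI[of _ p'] conjI allI impI)
    show "0 \<le> p' x" for x using p(1) by (simp add: p'_def)
    show "sum p' (insert c C) = measure M S"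
      using insert.hyps p'C[of "\<lambda>_. 1"] p(2) by (simp add: mS) (simp add: p'_def)
    fix g :: "'a \<Rightarrow> real" and L
    assume g [measurable]: "g \<in> borel_measurable borel" and g1: "\<forall>x. \<bar>g x\<bar> \<le> 1" and L: "0 \<le> L"
      and lip: "\<forall>x y. \<bar>g x - g y\<bar> \<le> L * dist x y"
    have int: "set_integrable M T f" if [measurable]: "T \<in> sets borel" "f \<in> borel_measurable borel"
      and "\<And>x. \<bar>f x\<bar> \<le> K" for T K and f :: "'a \<Rightarrow> real"
      unfolding set_integrable_def
    proof (rule integrable_const_bound[where B = K])
      have "0 \<le> K" using that(3)[of undefined] by linarith
      then show "AE x in M. norm (indicat_real T x *\<^sub>R f x) \<le> K"
        using that(3) by (intro always_eventually allI) (simp add: indicator_def)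
    qed measurable
    have split: "set_lebesgue_integral M S g = set_lebesgue_integral M A g + set_lebesgue_integral M B g"
      unfolding AB(1) using g1 by (intro set_integral_Un AB int[where K = 1]) auto
    have cA: "set_lebesgue_integral M A (\<lambda>_. k) = measure M A * k" for k
      by (simp add: set_lebesgue_integral_def)
    have "set_lebesgue_integral M A g - measure M A * g c = set_lebesgue_integral M A (\<lambda>x. g x - g c)"
      using g1 by (subst set_integral_diff(2)) (auto simp: cA intro!: int[where K = 1])
    also have "\<bar>\<dots>\<bar> \<le> set_lebesgue_integral M A (\<lambda>x. \<bar>g x - g c\<bar>)"
      unfolding set_lebesgue_integral_def real_norm_def[symmetric]
      by (rule order_trans[OF integral_norm_bound]) (simp add: abs_mult)
    also have "\<dots> \<le> set_lebesgue_integral M A (\<lambda>x. L * \<delta>)"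
    proof (rule set_integral_mono)
      show "set_integrable M A (\<lambda>x. \<bar>g x - g c\<bar>)"
      proof (intro int[where K = 2])
        show "\<bar>\<bar>g x - g c\<bar>\<bar> \<le> 2" for x
          using g1[rule_format, of x] g1[rule_format, of c] by linarith
      qed measurable
      show "set_integrable M A (\<lambda>x. L * \<delta>)" by (intro int[where K = "\<bar>L * \<delta>\<bar>"]) auto
      fix x assume "x \<in> A"
      then have "dist x c \<le> \<delta>" by (auto simp: A_def dist_commute)
      then show "\<bar>g x - g c\<bar> \<le> L * \<delta>"
        using lip L by (meson mult_left_mono order_trans)
    qed
    finally have "\<bar>set_lebesgue_integral M A g - measure M A * g c\<bar> \<le> L * \<delta> * measure M A"
      by (simp add: cA mult_ac)
    moreover have "\<bar>set_lebesgue_integral M B g - (\<Sum>x\<in>C. p x * g x)\<bar> \<le> L * \<delta> * measure M B"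
      using err g g1 L lip by blast
    moreover have "(\<Sum>x\<in>insert c C. p' x * g x) = measure M A * g c + (\<Sum>x\<in>C. p x * g x)"
      using insert.hyps by (simp add: p'C) (simp add: p'_def)
    ultimately show "\<bar>set_lebesgue_integral M S g - (\<Sum>x\<in>insert c C. p' x * g x)\<bar> \<le> L * \<delta> * measure M S"
      unfolding split mS distrib_left by linarith
  qed
qed

text \<open>As a function of the direction, the kernel at radius \<open>r\<close> has Lipschitz
  constant \<open>r\<close>, which gives the factor \<open>r * \<delta>\<close>. All radii share the
  same directions and weights.\<close>

lemma sphere_quadrature:
  assumes "\<delta> > 0"
  shows "\<exists>P p. finite P \<and> P \<subseteq> sphere (0::real^3) 1 \<and> (\<forall>u. 0 \<le> p u) \<and> sum p P = 1 \<and>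
    (\<forall>r\<ge>0. \<forall>x. \<bar>norm x * r * (\<Sum>u\<in>P. p u * exp (- dist x (r *\<^sub>R u))) - radial_kernel r (norm x)\<bar>
        \<le> norm x * r * (r * \<delta>))"
proof -
  interpret finite_measure unit_ball_measure by (rule finite_measure_unit_ball_measure)
  obtain P where P: "P \<subseteq> sphere (0::real^3) 1" "finite P" "sphere 0 1 \<subseteq> (\<Union>x\<in>P. ball x \<delta>)"
    by (rule compactE_image[of "sphere (0::real^3) 1" "sphere 0 1" "\<lambda>x. ball x \<delta>"]) (use assms in auto)
  define M where "M = distr unit_ball_measure borel (sgn :: real^3 \<Rightarrow> real^3)"
  have [measurable]: "(sgn :: real^3 \<Rightarrow> real^3) \<in> borel_measurable borel"
    unfolding sgn_div_norm by measurable
  have M: "finite_measure M" "sets M = sets borel"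
    unfolding M_def by (auto intro!: finite_measure_distr)
  note M(2)[measurable_cong]
  have AE_M: "AE u in M. u \<in> sphere 0 1"
    unfolding M_def using unit_ball_measure_AE_nonzero by (subst AE_distr_iff) (auto simp: norm_sgn)
  have M1: "measure M (sphere 0 1) = 1"
  proof -
    have "measure M (sphere 0 1) = measure M UNIV"
      using AE_M by (intro finite_measure.finite_measure_eq_AE[OF M(1)]) (auto simp: M(2))
    also have "\<dots> = 1" by (simp add: M_def measure_distr measure_unit_ball_measure_UNIV)
    finally show ?thesis .
  qed
  have sphere_borel [measurable]: "sphere (0::real^3) 1 \<in> sets borel" by simp
  from lipschitz_quadrature[OF M P(2) sphere_borel P(3)]
  obtain p where p: "\<forall>x. 0 \<le> p x" "sum p P = measure M (sphere 0 1)"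
    and err: "\<forall>g L. g \<in> borel_measurable borel \<longrightarrow> (\<forall>x. \<bar>g x\<bar> \<le> 1) \<longrightarrow> 0 \<le> L \<longrightarrow>
      (\<forall>x y. \<bar>g x - g y\<bar> \<le> L * dist x y) \<longrightarrow>
      \<bar>set_lebesgue_integral M (sphere 0 1) g - (\<Sum>x\<in>P. p x * g x)\<bar> \<le> L * \<delta> * measure M (sphere 0 1)"
    by (elim exE conjE) (rule that)
  have "\<bar>norm x * r * (\<Sum>u\<in>P. p u * exp (- dist x (r *\<^sub>R u))) - radial_kernel r (norm x)\<bar> \<le> norm x * r * (r * \<delta>)"
    if r: "r \<ge> 0" for r and x :: "real^3"
  proof -
    let ?g = "\<lambda>u. exp (- dist x (r *\<^sub>R u))"
    have lip: "\<bar>?g u - ?g w\<bar> \<le> r * dist u w" for u w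
    proof -
      have "\<bar>exp (- s) - exp (- t)\<bar> \<le> \<bar>s - t\<bar>" if "s \<ge> 0" "t \<ge> 0" for s t :: real
      proof -
        have "norm (exp (- s) - exp (- t)) \<le> 1 * norm (s - t)"
          by (intro field_differentiable_bound[of "{0..}" _ "\<lambda>z. - exp (- z)"])
             (use that in \<open>auto intro!: derivative_eq_intros\<close>)
        then show ?thesis by simp
      qed
      from this[of "dist x (r *\<^sub>R u)" "dist x (r *\<^sub>R w)"]
      have "\<bar>?g u - ?g w\<bar> \<le> \<bar>dist x (r *\<^sub>R u) - dist x (r *\<^sub>R w)\<bar>" by simp
      also have "\<dots> \<le> dist (r *\<^sub>R u) (r *\<^sub>R w)"
        using dist_triangle2[of x "r *\<^sub>R u" "r *\<^sub>R w"] dist_triangle2[of x "r *\<^sub>R w" "r *\<^sub>R u"]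
        by (simp add: abs_le_iff dist_commute algebra_simps)
      also have "\<dots> = r * dist u w" using r by (simp add: dist_norm flip: scaleR_diff_right)
      finally show ?thesis .
    qed
    have [measurable]: "?g \<in> borel_measurable borel" by measurable
    have "set_lebesgue_integral M (sphere 0 1) ?g = (\<integral>u. ?g u \<partial>M)"
      unfolding set_lebesgue_integral_def
    proof (rule integral_cong_AE)
      show "AE u in M. indicat_real (sphere 0 1) u *\<^sub>R ?g u = ?g u"
        using AE_M by (rule eventually_mono) (simp add: indicator_def)
    qed measurable
    also have "\<dots> = (\<integral>y. exp (- dist x (r *\<^sub>R sgn y)) \<partial>unit_ball_measure)"
      unfolding M_def by (rule integral_distr) auto
    finally have I: "norm x * r * set_lebesgue_integral M (sphere 0 1) ?g = radial_kernel r (norm x)"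
      using sphere_average[OF r, of x] by simp
    have e: "\<bar>set_lebesgue_integral M (sphere 0 1) ?g - (\<Sum>u\<in>P. p u * ?g u)\<bar> \<le> r * \<delta>"
    proof -
      have "\<forall>u. \<bar>?g u\<bar> \<le> 1" "\<forall>u w. \<bar>?g u - ?g w\<bar> \<le> r * dist u w" using lip by simp_all
      then have "\<bar>set_lebesgue_integral M (sphere 0 1) ?g - (\<Sum>u\<in>P. p u * ?g u)\<bar> \<le> r * \<delta> * measure M (sphere 0 1)"
        using err \<open>?g \<in> borel_measurable borel\<close> r by blast
      then show ?thesis by (simp add: M1)
    qed
    have "\<bar>norm x * r * (\<Sum>u\<in>P. p u * ?g u) - radial_kernel r (norm x)\<bar>
        = norm x * r * \<bar>set_lebesgue_integral M (sphere 0 1) ?g - (\<Sum>u\<in>P. p u * ?g u)\<bar>"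
      unfolding I[symmetric] right_diff_distrib[symmetric] using r
      by (simp add: abs_mult abs_minus_commute)
    also have "\<dots> \<le> norm x * r * (r * \<delta>)" using e r by (intro mult_left_mono) auto
    finally show ?thesis .
  qed
  then show ?thesis using P p M1 by (intro exI[of _ P] exI[of _ p]) auto
qed

definition node :: "real \<Rightarrow> nat \<Rightarrow> nat \<Rightarrow> real" where
  "node R n j = real j * (R / Suc n)"

text \<open>The Riemann sum occupies the nodes 0 to \<open>n\<close>; node \<open>Suc n\<close> is
  the radius R and carries the surface term. The backward quotient adds a weight of order 1 / h at R
  and removes it at node \<open>n\<close>, which is R - h.\<close>

definition node_weight :: "real \<Rightarrow> nat \<Rightarrow> nat \<Rightarrow> real" where
  "node_weight R n j = (let h = R / Suc n in
     (if j = Suc n then (2 * R + 3) / 2 + (R + 2) / 2 / h else h * (j * h / 2))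
     - (if j = n then (R + 2) / 2 / h else 0))"

lemma radial_sum_eq_node_sum:
  assumes "R > 0"
  shows "radial_sum R n f = (\<Sum>j\<le>Suc n. node_weight R n j * f (node R n j))"
proof -
  define h where "h = R / Suc n"
  have h: "h > 0" "real n * h = R - h" "real (Suc n) * h = R"
    using assms by (simp_all add: h_def field_simps)
  have nw: "node_weight R n j = (if j = Suc n then (2 * R + 3) / 2 + (R + 2) / 2 / h else h * (j * h / 2))
     - (if j = n then (R + 2) / 2 / h else 0)" and nd: "node R n j = j * h" for j
    unfolding node_weight_def node_def Let_def h_def by simp_all
  have "(\<Sum>j\<le>Suc n. node_weight R n j * f (node R n j))
      = (\<Sum>j<Suc n. (h * (j * h / 2) - (if j = n then (R + 2) / 2 / h else 0)) * f (j * h))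
        + ((2 * R + 3) / 2 + (R + 2) / 2 / h) * f (Suc n * h)"
    unfolding lessThan_Suc_atMost[symmetric] sum.lessThan_Suc[of _ "Suc n"]
    unfolding nw nd by (intro arg_cong2[where f = "(+)"] sum.cong) auto
  also have "(\<Sum>j<Suc n. (h * (j * h / 2) - (if j = n then (R + 2) / 2 / h else 0)) * f (j * h))
      = (\<Sum>j<Suc n. h * (j * h / 2 * f (j * h))) - (\<Sum>j<Suc n. if j = n then (R + 2) / 2 / h * f (j * h) else 0)"
    unfolding sum_subtractf[symmetric] by (intro sum.cong) (auto simp: algebra_simps)
  also have "(\<Sum>j<Suc n. if j = n then (R + 2) / 2 / h * f (j * h) else 0) = (R + 2) / 2 / h * f (R - h)"
    by (simp add: h(2))
  finally have "(\<Sum>j\<le>Suc n. node_weight R n j * f (node R n j))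
      = (\<Sum>j<Suc n. h * (j * h / 2 * f (j * h))) - (R + 2) / 2 / h * f (R - h)
        + ((2 * R + 3) / 2 + (R + 2) / 2 / h) * f R"
    by (simp only: h(3))
  moreover have "S - b / h * y + (c + b / h) * x = S + c * x + b * ((x - y) / h)" for S b c x y :: real
    using h(1) by (simp add: field_simps)
  ultimately show ?thesis
    unfolding radial_sum_def Let_def h_def[symmetric] by (simp only:)
qed

theorem theorem2:
  fixes a :: "real ^ 3" and R :: real
  assumes "R > 0"
  shows "magnitude (cball a R) = ereal (R ^ 3 / fact 3 + R ^ 2 + 2 * R + 1)"
proof -
  \<comment> \<open>The total variation \<open>B n\<close> grows at least like 1 / h, so the angular
    mesh \<open>\<delta> n\<close> is chosen depending on \<open>n\<close>. The energy pairs the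
    quadrature error with the charge once more, hence the square in \<open>D n\<close>.\<close>
  define B where "B n = (\<Sum>j\<le>Suc n. \<bar>node_weight R n j\<bar>)" for n
  define D where "D n = (1 + B n)\<^sup>2 * (1 + R ^ 3)" for n
  define \<delta> where "\<delta> n = 1 / (real (Suc n) * D n)" for n
  let ?N = "\<lambda>n. {..Suc n}" and ?b = "node_weight R" and ?r = "node R"
  have B: "B n \<ge> 0" for n by (simp add: B_def sum_nonneg)
  have D: "D n > 0" for n using B[of n] assms by (simp add: D_def add_pos_nonneg)
  have \<delta>: "\<delta> n > 0" for n using D by (simp add: \<delta>_def)
  have r: "0 \<le> ?r n j" "j \<le> Suc n \<Longrightarrow> ?r n j \<le> R" for n j
    using assms mult_left_mono[of "real j" "1 + real n" R] by (auto simp: node_def field_simps)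
  define Q where "Q n P p \<longleftrightarrow> finite P \<and> P \<subseteq> sphere (0::real^3) 1 \<and> (\<forall>u. 0 \<le> p u) \<and> sum p P = 1 \<and>
    (\<forall>r\<ge>0. \<forall>x. \<bar>norm x * r * (\<Sum>u\<in>P. p u * exp (- dist x (r *\<^sub>R u))) - radial_kernel r (norm x)\<bar>
        \<le> norm x * r * (r * \<delta> n))" for n P p
  have "\<exists>P p. Q n P p" for n unfolding Q_def by (rule sphere_quadrature[OF \<delta>])
  then obtain P p where Q: "\<And>n. Q n (P n) (p n)" by metis
  have P: "finite (P n)" "P n \<subseteq> sphere (0::real^3) 1" "0 \<le> p n u" "sum (p n) (P n) = 1" for n u
    using Q[of n] unfolding Q_def by simp_all
  have quad: "\<bar>norm x * s * (\<Sum>u\<in>P n. p n u * exp (- dist x (s *\<^sub>R u))) - radial_kernel s (norm x)\<bar>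
        \<le> norm x * s * (s * \<delta> n)" if "0 \<le> s" for n s x
    using Q[of n] that unfolding Q_def by blast
  define I where "I n = ?N n \<times> P n" for n
  \<comment> \<open>In the convention of \<open>radial_sum\<close> the sphere at node j has total
    charge \<open>?b n j * ?r n j\<close>; the weights \<open>p n\<close> share it among the
    directions.\<close>
  define v where "v n i = ?b n (fst i) * ?r n (fst i) * p n (snd i)" for n i
  define q where "q n i = a + ?r n (fst i) *\<^sub>R snd i" for n i
  define V where "V n x = (\<Sum>i\<in>I n. v n i * exp (- dist x (?r n (fst i) *\<^sub>R snd i)))" for n x
  have V_eq: "V n x = (\<Sum>j\<le>Suc n. ?b n j * (?r n j * (\<Sum>u\<in>P n. p n u * exp (- dist x (?r n j *\<^sub>R u)))))" for n x
    unfolding V_def I_def sum.Sigma[symmetric] sum.cartesian_product'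
    by (simp add: v_def sum_distrib_left mult_ac)
  have V_err: "\<bar>norm x * V n x - radial_sum R n (\<lambda>s. radial_kernel s (norm x))\<bar> \<le> B n * (R ^ 3 * \<delta> n)"
    if x: "norm x \<le> R" for n x
  proof -
    have "norm x * V n x - radial_sum R n (\<lambda>s. radial_kernel s (norm x))
      = (\<Sum>j\<le>Suc n. ?b n j * (norm x * ?r n j * (\<Sum>u\<in>P n. p n u * exp (- dist x (?r n j *\<^sub>R u)))
            - radial_kernel (?r n j) (norm x)))"
      unfolding V_eq radial_sum_eq_node_sum[OF assms]
      by (simp only: sum_distrib_left[of "norm x"] sum_subtractf[symmetric] right_diff_distrib mult_ac)
    also have "\<bar>\<dots>\<bar> \<le> (\<Sum>j\<le>Suc n. \<bar>?b n j\<bar> * (R ^ 3 * \<delta> n))"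
    proof (rule order_trans[OF sum_abs sum_mono])
      fix j assume "j \<in> {..Suc n}"
      then have rj: "0 \<le> ?r n j" "?r n j \<le> R" using r by auto
      have "norm x * ?r n j * (?r n j * \<delta> n) \<le> R * R * (R * \<delta> n)"
        using x rj \<delta>[of n] assms by (intro mult_mono) auto
      then have "\<bar>norm x * ?r n j * (\<Sum>u\<in>P n. p n u * exp (- dist x (?r n j *\<^sub>R u))) - radial_kernel (?r n j) (norm x)\<bar>
          \<le> R ^ 3 * \<delta> n"
        using quad[OF rj(1), of x n] by (simp add: power3_eq_cube)
      then show "\<bar>?b n j * (norm x * ?r n j * (\<Sum>u\<in>P n. p n u * exp (- dist x (?r n j *\<^sub>R u))) - radial_kernel (?r n j) (norm x))\<bar>
          \<le> \<bar>?b n j\<bar> * (R ^ 3 * \<delta> n)"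
        unfolding abs_mult by (rule mult_left_mono) simp
    qed
    also have "\<dots> = B n * (R ^ 3 * \<delta> n)" unfolding B_def sum_distrib_right ..
    finally show ?thesis .
  qed
  have small: "B n * (R ^ 3 * \<delta> n) \<le> 1 / Suc n" "B n * (B n * (R ^ 3 * \<delta> n)) \<le> 1 / Suc n" for n
  proof -
    have "B n * R ^ 3 \<le> D n" "B n * B n * R ^ 3 \<le> D n"
      using B[of n] assms by (auto simp: D_def power2_eq_square algebra_simps intro!: add_nonneg_nonneg)
    then have "B n * R ^ 3 / D n \<le> 1" "B n * B n * R ^ 3 / D n \<le> 1" using D[of n] by simp_all
    then have "B n * R ^ 3 / D n / Suc n \<le> 1 / Suc n" "B n * B n * R ^ 3 / D n / Suc n \<le> 1 / Suc n"
      by (intro divide_right_mono; simp)+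
    then show "B n * (R ^ 3 * \<delta> n) \<le> 1 / Suc n" "B n * (B n * (R ^ 3 * \<delta> n)) \<le> 1 / Suc n"
      by (simp_all add: \<delta>_def mult_ac)
  qed
  have lim: "f \<longlonglongrightarrow> l" if "g \<longlonglongrightarrow> l" "\<And>n. \<bar>f n - g n\<bar> \<le> 1 / Suc n" for f g and l :: real
  proof -
    have "(\<lambda>n. f n - g n) \<longlonglongrightarrow> 0"
      by (rule Lim_null_comparison[OF _ LIMSEQ_Suc[OF lim_1_over_n]]) (use that(2) in auto)
    from tendsto_add[OF this that(1)] show ?thesis by simp
  qed
  have "magnitude (cball a R) = ereal (R ^ 3 / 6 + R\<^sup>2 + 2 * R + 1)"
  proof (rule magnitude_eqI[where I = I and p = q and v = v])
    show "finite (I n)" for n using P by (simp add: I_def)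
    show "q n i \<in> cball a R" if "i \<in> I n" for n i
    proof -
      have "norm (snd i) = 1" "fst i \<le> Suc n" using that P(2)[of n] by (auto simp: I_def)
      then show ?thesis using r(1)[of n "fst i"] r(2)[of "fst i" n] by (simp add: q_def dist_norm)
    qed
    show "R ^ 3 / 6 + R\<^sup>2 + 2 * R + 1 > 0" using assms by (simp add: add_pos_pos)
    have dist_q: "dist x (q n i) = dist (x - a) (?r n (fst i) *\<^sub>R snd i)" for x n i
      by (simp add: q_def dist_norm algebra_simps)
    show "(\<lambda>n. \<Sum>i\<in>I n. v n i * exp (- dist x (q n i))) \<longlonglongrightarrow> 1" if x: "x \<in> cball a R" for x
    proof (cases "x = a")
      \<comment> \<open>The charges of one node sphere are all equally far from the centre, so here
        no quadrature error arises.\<close>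
      case True
      have "V n 0 = radial_sum R n (\<lambda>r. r * exp (- r))" for n
      proof -
        have "(\<Sum>u\<in>P n. p n u * exp (- dist 0 (s *\<^sub>R u))) = exp (- s)" if "s \<ge> 0" for s
        proof -
          have "(\<Sum>u\<in>P n. p n u * exp (- dist 0 (s *\<^sub>R u))) = (\<Sum>u\<in>P n. p n u * exp (- s))"
            using P(2)[of n] that by (intro sum.cong) auto
          then show ?thesis by (simp add: P(4) flip: sum_distrib_right)
        qed
        then show ?thesis unfolding V_eq radial_sum_eq_node_sum[OF assms] by (simp add: r)
      qed
      then show ?thesis using radial_sum_centre[OF assms] True
        unfolding dist_q V_def[symmetric] by simp
    next
      case False
      have nx: "0 < norm (x - a)" "norm (x - a) \<le> R" using x False by (auto simp: dist_norm norm_minus_commute)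
      have "(\<lambda>n. radial_sum R n (\<lambda>s. radial_kernel s (norm (x - a)))) \<longlonglongrightarrow> norm (x - a)"
        by (rule LIM_zero_cancel, rule Lim_null_comparison[OF always_eventually mesh_tendsto_0])
           (use radial_sum_kernel_error[OF assms _ nx(2)] in auto)
      then have "(\<lambda>n. norm (x - a) * V n (x - a)) \<longlonglongrightarrow> norm (x - a)"
        by (rule lim) (use V_err[OF nx(2)] small(1) order_trans in blast)
      then have "(\<lambda>n. norm (x - a) * V n (x - a) / norm (x - a)) \<longlonglongrightarrow> norm (x - a) / norm (x - a)"
        by (intro tendsto_divide tendsto_const) (use nx in auto)
      then show ?thesis using nx unfolding dist_q V_def[symmetric] by simp
    qed
    show "(\<lambda>n. \<Sum>i\<in>I n. v n i) \<longlonglongrightarrow> R ^ 3 / 6 + R\<^sup>2 + 2 * R + 1"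
    proof -
      have "(\<Sum>i\<in>I n. v n i) = radial_sum R n (\<lambda>r. r)" for n
        unfolding I_def sum.cartesian_product' radial_sum_eq_node_sum[OF assms]
        by (simp add: v_def P(4) flip: sum_distrib_left)
      then show ?thesis using radial_sum_id[OF assms] by simp
    qed
    show "(\<lambda>n. \<Sum>i\<in>I n. \<Sum>j\<in>I n. v n i * v n j * exp (- dist (q n i) (q n j)))
        \<longlonglongrightarrow> R ^ 3 / 6 + R\<^sup>2 + 2 * R + 1"
    proof (rule lim[OF radial_energy_tendsto[OF assms]])
      fix n
      let ?W = "\<lambda>s. radial_sum R n (\<lambda>r. radial_kernel r s)"
      have "(\<Sum>i\<in>I n. \<Sum>j\<in>I n. v n i * v n j * exp (- dist (q n i) (q n j)))
          = (\<Sum>i\<in>I n. v n i * V n (?r n (fst i) *\<^sub>R snd i))"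
        unfolding V_def sum_distrib_left dist_q by (simp add: q_def mult_ac)
      also have "\<dots> = (\<Sum>j\<le>Suc n. \<Sum>u\<in>P n. ?b n j * p n u * (?r n j * V n (?r n j *\<^sub>R u)))"
        unfolding I_def sum.cartesian_product' by (simp add: v_def mult_ac)
      finally have E: "(\<Sum>i\<in>I n. \<Sum>j\<in>I n. v n i * v n j * exp (- dist (q n i) (q n j)))
          = (\<Sum>j\<le>Suc n. \<Sum>u\<in>P n. ?b n j * p n u * (?r n j * V n (?r n j *\<^sub>R u)))" .
      \<comment> \<open>Because \<open>p n\<close> sums to 1, the radial energy can be spread over
        the directions and compared term by term.\<close>
      have W: "radial_sum R n ?W = (\<Sum>j\<le>Suc n. \<Sum>u\<in>P n. ?b n j * p n u * ?W (?r n j))"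
        unfolding radial_sum_eq_node_sum[OF assms, of n ?W]
        by (simp add: P(4) flip: sum_distrib_left sum_distrib_right)
      have "\<bar>(\<Sum>i\<in>I n. \<Sum>j\<in>I n. v n i * v n j * exp (- dist (q n i) (q n j))) - radial_sum R n ?W\<bar>
          = \<bar>\<Sum>j\<le>Suc n. \<Sum>u\<in>P n. ?b n j * p n u * (?r n j * V n (?r n j *\<^sub>R u) - ?W (?r n j))\<bar>"
        unfolding E W by (simp only: sum_subtractf[symmetric] right_diff_distrib)
      also have "\<dots> \<le> (\<Sum>j\<le>Suc n. \<Sum>u\<in>P n. \<bar>?b n j\<bar> * p n u * (B n * (R ^ 3 * \<delta> n)))"
      proof (rule order_trans[OF sum_abs sum_mono], rule order_trans[OF sum_abs sum_mono])
        fix j u assume j: "j \<in> {..Suc n}" and u: "u \<in> P n"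
        have "norm (?r n j *\<^sub>R u) = ?r n j" using u P(2)[of n] r by auto
        then have "\<bar>?r n j * V n (?r n j *\<^sub>R u) - ?W (?r n j)\<bar> \<le> B n * (R ^ 3 * \<delta> n)"
          using V_err[of "?r n j *\<^sub>R u" n] r(2)[of j n] j by simp
        then show "\<bar>?b n j * p n u * (?r n j * V n (?r n j *\<^sub>R u) - ?W (?r n j))\<bar>
            \<le> \<bar>?b n j\<bar> * p n u * (B n * (R ^ 3 * \<delta> n))"
          using P(3)[of n u] by (simp add: abs_mult mult_left_mono)
      qed
      also have "\<dots> = B n * (B n * (R ^ 3 * \<delta> n))"
        by (simp add: B_def P(4) flip: sum_distrib_left sum_distrib_right)
      also have "\<dots> \<le> 1 / Suc n" by (rule small)
      finally show "\<bar>(\<Sum>i\<in>I n. \<Sum>j\<in>I n. v n i * v n j * exp (- dist (q n i) (q n j))) - radial_sum R n ?W\<bar> \<le> 1 / Suc n" .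
    qed
  qed
  then show ?thesis by (simp add: fact_numeral)
qed


end
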